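(* Let $(u(x-ct,y),v(x-ct,y))$, with profile $(u,v)\in C^2(D_L)$ and wave speed $c$, be a traveling-wave solution of the $\beta$-plane equation in $D_L=\mathbb T_L\times[-d,d]$ with $v=0$ on $y=\pm d$, and suppose $\beta\notin\mathrm{Ran}(\Delta u)$. Assume that one of the following conditions holds: (i) $\beta>0$, $c\notin[c_\beta^+,u_{\min}]$, and $\nabla u\neq0$ everywhere on $D_L$, where $$c_\beta^+=u_{\min}-\frac{2\beta d^2}{\pi^2}-\frac{2d^2}{\pi^2}\sqrt{\beta^2+\frac{\pi^2\beta}{d^2}(u_{\max}-u_{\min})};$$ (ii) $\beta=0$ and $c\in\mathbb R$ is arbitrary. Then $(u(x-ct,y),v(x-ct,y))$ is a shear flow.
   Context: Let $L,d>0$, $\mathbb T_L=\mathbb R/L\mathbb Z$, $D_L=\mathbb T_L\times[-d,d]$. For a constant $\beta\ge0$, the $\beta$-plane equation on $D_L$ is $$u_t+uu_x+vu_y-\beta yv=-P_x,\quad v_t+uv_x+vv_y+\beta yu=-P_y,\quad u_x+v_y=0,$$ with boundary condition $v=0$ on $y=\pm d$ ($P$ is the pressure). A traveling-wave solution of speed $c\in\mathbb R$ is a solution (for some pressure) of the form $(u(x-ct,y),v(x-ct,y))$; $(u,v)\in C^2(D_L)$ means that the profiles are $L$-periodic in the first variable and $C^2$ up to the boundary. It is a shear flow if $v\equiv0$ on $D_L$ (so that $u$ depends only on $y$). $u_{\max},u_{\min}$ are the maximum and minimum of $u$ over $D_L$, $\mathrm{Ran}(f)$ is the range of $f$ on $D_L$,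 and $\Delta=\partial_x^2+\partial_y^2$. *)

theory Defs
  imports "HOL-Analysis.Analysis"
begin

text \<open>
  Functions on \<open>D_L = (R / L Z) \<times> [-d, d]\<close> are represented by functions on the plane that are
  \<open>L\<close>-periodic in the first variable over the closed strip; their values off the strip are
  irrelevant. Time-dependent functions take the time as an additional first argument.
\<close>

definition strip :: "real \<Rightarrow> (real \<times> real) set" where
  "strip d = UNIV \<times> {-d..d}"

definition periodic_x :: "real \<Rightarrow> real \<Rightarrow> (real \<times> real \<Rightarrow> real) \<Rightarrow> bool" where
  "periodic_x L d f \<longleftrightarrow> (\<forall>x. \<forall>y\<in>{-d..d}. f (x + L, y) = f (x, y))"

definition ddx :: "(real \<times> real \<Rightarrow> real) \<Rightarrow> real \<times> real \<Rightarrow> real" where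
  "ddx f = (\<lambda>(x, y). vector_derivative (\<lambda>s. f (s, y)) (at x))"

text \<open>The \<open>y\<close>-derivative is relative to \<open>[-d, d]\<close>, hence one-sided at \<open>y = -d\<close> and \<open>y = d\<close>.\<close>

definition ddy :: "real \<Rightarrow> (real \<times> real \<Rightarrow> real) \<Rightarrow> real \<times> real \<Rightarrow> real" where
  "ddy d f = (\<lambda>(x, y). vector_derivative (\<lambda>s. f (x, s)) (at y within {-d..d}))"

definition C1_strip :: "real \<Rightarrow> (real \<times> real \<Rightarrow> real) \<Rightarrow> bool" where
  "C1_strip d f \<longleftrightarrow>
     (\<forall>x. \<forall>y\<in>{-d..d}. (\<lambda>s. f (s, y)) differentiable (at x)
        \<and> (\<lambda>s. f (x, s)) differentiable (at y within {-d..d}))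
     \<and> continuous_on (strip d) f
     \<and> continuous_on (strip d) (ddx f) \<and> continuous_on (strip d) (ddy d f)"

definition C2_strip :: "real \<Rightarrow> (real \<times> real \<Rightarrow> real) \<Rightarrow> bool" where
  "C2_strip d f \<longleftrightarrow> C1_strip d f \<and> C1_strip d (ddx f) \<and> C1_strip d (ddy d f)"

definition grad :: "real \<Rightarrow> (real \<times> real \<Rightarrow> real) \<Rightarrow> real \<times> real \<Rightarrow> real \<times> real" where
  "grad d f p = (ddx f p, ddy d f p)"

definition laplacian :: "real \<Rightarrow> (real \<times> real \<Rightarrow> real) \<Rightarrow> real \<times> real \<Rightarrow> real" where
  "laplacian d f p = ddx (ddx f) p + ddy d (ddy d f) p"

definition ddt :: "(real \<Rightarrow> real \<times> real \<Rightarrow> real) \<Rightarrow> real \<Rightarrow> real \<times> real \<Rightarrow> real" where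
  "ddt F t p = vector_derivative (\<lambda>s. F s p) (at t)"

text \<open>Classical solutions, with the equations holding up to the boundary. The pressure is a
  function on \<open>D_L\<close>, hence periodic as well; no regularity in time is required of it.\<close>

definition beta_plane_solution ::
  "real \<Rightarrow> real \<Rightarrow> real \<Rightarrow> (real \<Rightarrow> real \<times> real \<Rightarrow> real) \<Rightarrow> (real \<Rightarrow> real \<times> real \<Rightarrow> real)
    \<Rightarrow> (real \<Rightarrow> real \<times> real \<Rightarrow> real) \<Rightarrow> bool" where
  "beta_plane_solution \<beta> L d U V P \<longleftrightarrow>
     (\<forall>t. periodic_x L d (U t) \<and> periodic_x L d (V t) \<and> periodic_x L d (P t)
        \<and> C1_strip d (U t) \<and> C1_strip d (V t) \<and> C1_strip d (P t))
     \<and> (\<forall>t. \<forall>p\<in>strip d. (\<lambda>s. U s p) differentiable (at t) \<and> (\<lambda>s. V s p) differentiable (at t))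
     \<and> (\<forall>t x. \<forall>y\<in>{-d..d}. let p = (x, y) in
          ddt U t p + U t p * ddx (U t) p + V t p * ddy d (U t) p - \<beta> * y * V t p = - ddx (P t) p
        \<and> ddt V t p + U t p * ddx (V t) p + V t p * ddy d (V t) p + \<beta> * y * U t p = - ddy d (P t) p
        \<and> ddx (U t) p + ddy d (V t) p = 0)
     \<and> (\<forall>t x. V t (x, -d) = 0 \<and> V t (x, d) = 0)"

definition traveling :: "real \<Rightarrow> (real \<times> real \<Rightarrow> real) \<Rightarrow> real \<Rightarrow> real \<times> real \<Rightarrow> real" where
  "traveling c f t = (\<lambda>(x, y). f (x - c * t, y))"

definition traveling_wave_solution ::
  "real \<Rightarrow> real \<Rightarrow> real \<Rightarrow> real \<Rightarrow> (real \<times> real \<Rightarrow> real) \<Rightarrow> (real \<times> real \<Rightarrow> real) \<Rightarrow> bool" where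
  "traveling_wave_solution \<beta> L d c u v \<longleftrightarrow>
     (\<exists>P. beta_plane_solution \<beta> L d (traveling c u) (traveling c v) P)"

definition shear_flow :: "real \<Rightarrow> (real \<Rightarrow> real \<times> real \<Rightarrow> real) \<Rightarrow> (real \<Rightarrow> real \<times> real \<Rightarrow> real) \<Rightarrow> bool" where
  "shear_flow d U V \<longleftrightarrow> (\<forall>t. \<forall>p\<in>strip d. V t p = 0)"

text \<open>For continuous periodic functions the supremum and infimum are attained.\<close>

definition max_strip :: "real \<Rightarrow> (real \<times> real \<Rightarrow> real) \<Rightarrow> real" where
  "max_strip d f = Sup (f ` strip d)"

definition min_strip :: "real \<Rightarrow> (real \<times> real \<Rightarrow> real) \<Rightarrow> real" where
  "min_strip d f = Inf (f ` strip d)"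

definition c_beta_plus :: "real \<Rightarrow> real \<Rightarrow> (real \<times> real \<Rightarrow> real) \<Rightarrow> real" where
  "c_beta_plus \<beta> d u =
     min_strip d u - 2 * \<beta> * d\<^sup>2 / pi\<^sup>2
       - 2 * d\<^sup>2 / pi\<^sup>2 * sqrt (\<beta>\<^sup>2 + pi\<^sup>2 * \<beta> / d\<^sup>2 * (max_strip d u - min_strip d u))"

end

theory Submission
  imports Defs
begin

text \<open>
  Put \<open>w = u - c\<close>. Eliminating the pressure gives \<open>w \<Delta>v = v (\<Delta>u - \<beta>)\<close>, so
  \<open>q = \<Delta>v / (\<Delta>u - \<beta>)\<close> is continuous and \<open>v = q w\<close>. With \<open>Z = \<nabla>v - q \<nabla>w\<close>,
  which equals \<open>w \<nabla>q\<close> where \<open>w \<noteq> 0\<close> and vanishes where \<open>w = 0\<close>, one has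
  \<open>div (v Z) = |Z|\<^sup>2 - \<beta> w q\<^sup>2\<close>; the flux \<open>v Z\<close> may be cut off to \<open>{w < 0}\<close>.

  For \<open>\<beta> = 0\<close> this gives \<open>Z = 0\<close>, and then \<open>y (v w, v\<^sup>2)\<close> has divergence \<open>v\<^sup>2\<close>.
  For \<open>c < c\<^sub>\<beta>\<^sup>+\<close> the Poincare inequality in \<open>y\<close> with constant \<open>(\<pi> / (2 d))\<^sup>2\<close> yields \<open>q = 0\<close>.
  For \<open>\<beta> > 0\<close> and \<open>c > u\<^sub>m\<^sub>i\<^sub>n\<close>, the cut-off identity gives \<open>v = 0\<close> on \<open>{w < 0}\<close>. As
  \<open>\<nabla>u \<noteq> 0\<close>, the minimum of \<open>w\<close> lies on a boundary line; \<open>w\<close> is a negative constant there, so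
  \<open>v\<close> has zero Cauchy data on that line. Unique continuation across the zeros of \<open>w\<close>, where
  \<open>\<Delta>v = (\<Delta>u - \<beta>) v / w\<close> is singular, follows from a Carleman estimate with a weight depending
  only on \<open>y\<close> combined with a Hardy inequality: the zeros of \<open>w\<close> are simple in \<open>y\<close>.
\<close>

subsection \<open>Partial derivatives on the strip\<close>

text \<open>Relational counterpart of \<open>ddx\<close>: an explicit formula can be certified as
  the derivative, and values off the strip do not matter.\<close>

definition has_ddx :: "real \<Rightarrow> (real \<times> real \<Rightarrow> real) \<Rightarrow> (real \<times> real \<Rightarrow> real) \<Rightarrow> bool" where
  "has_ddx d f f' \<longleftrightarrow>
     (\<forall>x. \<forall>y\<in>{-d..d}. ((\<lambda>s. f (s, y)) has_real_derivative f' (x, y)) (at x))"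

definition has_ddy :: "real \<Rightarrow> (real \<times> real \<Rightarrow> real) \<Rightarrow> (real \<times> real \<Rightarrow> real) \<Rightarrow> bool" where
  "has_ddy d f f' \<longleftrightarrow>
     (\<forall>x. \<forall>y\<in>{-d..d}. ((\<lambda>s. f (x, s)) has_real_derivative f' (x, y)) (at y within {-d..d}))"

lemma has_ddxD:
  "has_ddx d f f' \<Longrightarrow> y \<in> {-d..d} \<Longrightarrow> ((\<lambda>s. f (s, y)) has_real_derivative f' (x, y)) (at x)"
  by (simp add: has_ddx_def)

lemma has_ddyD:
  "has_ddy d f f' \<Longrightarrow> y \<in> {-d..d} \<Longrightarrow>
    ((\<lambda>s. f (x, s)) has_real_derivative f' (x, y)) (at y within {-d..d})"
  by (simp add: has_ddy_def)

lemma has_real_derivative_cong_on: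
  fixes f g :: "real \<Rightarrow> real"
  assumes "x \<in> S" "\<And>t. t \<in> S \<Longrightarrow> g t = f t" "(f has_real_derivative f') (at x within S)"
  shows "(g has_real_derivative f') (at x within S)"
  by (rule has_field_derivative_transform_within[OF assms(3) zero_less_one assms(1)]) (simp add: assms(2))

lemma has_real_derivative_unique_within_Icc:
  fixes f :: "real \<Rightarrow> real"
  assumes "a < b" "x \<in> {a..b}"
    and "(f has_real_derivative y) (at x within {a..b})" "(f has_real_derivative z) (at x within {a..b})"
  shows "y = z"
  using assms vector_derivative_unique_within_closed_interval[of a b x]
  by (auto simp: has_real_derivative_iff_has_vector_derivative)

section \<open>Integration over a period cell and symmetry of mixed derivatives\<close>

lemma rectangle_subset_strip: "cbox (a, -d) (b, d) \<subseteq> strip d"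
  by (auto simp: strip_def cbox_Pair_eq)

lemma continuous_on_strip_slices:
  assumes "continuous_on (strip d) f"
  shows "y \<in> {-d..d} \<Longrightarrow> continuous_on S (\<lambda>s. f (s, y))"
    and "T \<subseteq> {-d..d} \<Longrightarrow> continuous_on T (\<lambda>s. f (x, s))"
  by (auto intro!: continuous_on_compose2[OF assms] continuous_intros simp: strip_def)

lemma integral_ddx:
  assumes "has_ddx d f f'" "a \<le> b" "y \<in> {-d..d}"
  shows "((\<lambda>s. f' (s, y)) has_integral f (b, y) - f (a, y)) {a..b}"
  by (rule fundamental_theorem_of_calculus[OF assms(2)])
    (use has_ddxD[OF assms(1,3)] in \<open>auto simp: has_real_derivative_iff_has_vector_derivative[symmetric]
      intro: has_field_derivative_at_within\<close>)

lemma integral_ddy: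
  assumes "has_ddy d f f'" "d > 0"
  shows "((\<lambda>s. f' (x, s)) has_integral f (x, d) - f (x, -d)) {-d..d}"
  by (rule fundamental_theorem_of_calculus)
    (use assms has_ddyD[OF assms(1)] in \<open>auto simp: has_real_derivative_iff_has_vector_derivative[symmetric]\<close>)

text \<open>Divergence theorem on one period cell: periodicity cancels the sides and
  \<open>flux\<close> gives the walls the good sign, so \<open>h\<close> has integral at most zero;
  a continuous nonnegative function with zero integral vanishes. Every vanishing result for
  \<open>v\<close> rests on this with a suitable flux \<open>(F, G)\<close>.\<close>

lemma vanishing_from_divergence:
  fixes L d :: real
  assumes "L > 0" "d > 0"
    and F: "has_ddx d F F'" "continuous_on (strip d) F'" "periodic_x L d F"
    and G: "has_ddy d G G'" "continuous_on (strip d) G'"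
    and flux: "\<And>x. x \<in> {0..L} \<Longrightarrow> G (x, d) \<le> G (x, -d)"
    and h: "continuous_on (strip d) h"
    and bound: "\<And>p. p \<in> {0..L} \<times> {-d..d} \<Longrightarrow> 0 \<le> h p \<and> h p \<le> F' p + G' p"
    and p: "p \<in> {0..L} \<times> {-d..d}"
  shows "h p = 0"
proof -
  let ?R = "cbox (0, -d) (L, d)"
  have R: "?R = {0..L} \<times> {-d..d}" by (simp add: cbox_Pair_eq)
  have cont: "continuous_on ?R F'" "continuous_on ?R G'" "continuous_on ?R h"
    using F(2) G(2) h rectangle_subset_strip continuous_on_subset by blast+
  have "integral ?R F' = integral (cbox 0 L) (\<lambda>x. integral (cbox (-d) d) (\<lambda>y. F' (x, y)))"
    by (rule integral_prod_continuous) (rule cont)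
  \<comment> \<open>Fubini puts the x-integral inside, where periodicity makes it zero.\<close>
  also have "\<dots> = integral (cbox (-d) d) (\<lambda>y. integral (cbox 0 L) (\<lambda>x. F' (x, y)))"
    by (rule integral_swap_continuous) (use cont(1) in simp)
  also have "\<dots> = integral (cbox (-d) d) (\<lambda>y. 0)"
  proof (rule integral_cong)
    fix y assume "y \<in> cbox (-d) d"
    then have y: "y \<in> {-d..d}" by simp
    have "F (0 + L, y) = F (0, y)" using F(3) y unfolding periodic_x_def by blast
    then show "integral (cbox 0 L) (\<lambda>x. F' (x, y)) = 0"
      using integral_ddx[OF F(1) _ y, of 0 L] \<open>L > 0\<close> by (simp add: integral_unique)
  qed
  finally have IF: "integral ?R F' = 0" by simp
  have "integral ?R G' = integral (cbox 0 L) (\<lambda>x. integral (cbox (-d) d) (\<lambda>y. G' (x, y)))"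
    by (rule integral_prod_continuous) (rule cont)
  also have "\<dots> \<le> 0"
  proof -
    have "integral (cbox 0 L) (\<lambda>x. integral (cbox (-d) d) (\<lambda>y. G' (x, y))) \<le> integral (cbox 0 L) (\<lambda>x. 0)"
    proof (rule integral_le)
      show "(\<lambda>x. integral (cbox (-d) d) (\<lambda>y. G' (x, y))) integrable_on cbox 0 L"
        by (rule integral_integrable_2dim) (rule cont)
      fix x assume "x \<in> cbox 0 L"
      then have "G (x, d) - G (x, -d) \<le> 0" using flux[of x] by simp
      then show "integral (cbox (-d) d) (\<lambda>y. G' (x, y)) \<le> 0"
        using integral_ddy[OF G(1) \<open>d > 0\<close>, of x] by (simp add: integral_unique)
    qed (rule integrable_0)
    then show ?thesis by simp
  qed
  finally have IG: "integral ?R G' \<le> 0" .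
  note int = integrable_continuous[OF cont(1)] integrable_continuous[OF cont(2)]
    integrable_continuous[OF cont(3)]
  have "integral ?R h \<le> integral ?R (\<lambda>p. F' p + G' p)"
    by (rule integral_le) (use int bound R in \<open>auto intro: integrable_add\<close>)
  also have "\<dots> = integral ?R F' + integral ?R G'"
    by (rule integral_add) (use int in auto)
  also have "\<dots> \<le> 0" using IF IG by simp
  finally have "integral ?R h \<le> 0" .
  moreover have "0 \<le> integral ?R h"
    by (rule integral_nonneg) (use int bound R in auto)
  ultimately have "(h has_integral 0) ?R"
    using int(3) by (metis antisym integrable_integral)
  moreover have "box (0, -d) (L, d) \<noteq> {}"
    using \<open>L > 0\<close> \<open>d > 0\<close> by (simp add: box_ne_empty Basis_prod_def)
  moreover have "0 \<le> h z" if "z \<in> box (0, -d) (L, d)" for z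
    using bound[of z] that box_subset_cbox R by blast
  ultimately show ?thesis
    using has_integral_0_cbox_imp_0[OF cont(3)] p R by blast
qed

text \<open>Only one mixed derivative is assumed continuous. Differentiating
  \<open>f (t, y) - f (a, y)\<close>, an integral of \<open>f1\<close>, under the integral sign
  writes \<open>f2 (t, y) - f2 (a, y)\<close> as an integral of \<open>f12\<close>; then
  differentiate in \<open>t\<close>. This form suits a pressure that is only C1.\<close>

lemma mixed_partials_commute:
  fixes d :: real
  assumes "d > 0"
    and f1: "has_ddx d f f1" and f2: "has_ddy d f f2"
    and f12: "has_ddy d f1 f12" and f21: "has_ddx d f2 f21"
    and c1: "continuous_on (strip d) f1"
    and c12: "continuous_on (strip d) f12"
    and y: "y \<in> {-d..d}"
  shows "f12 (x, y) = f21 (x, y)"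
proof -
  define a where "a = x - 1"
  have diff: "f2 (t, y) - f2 (a, y) = integral {a..t} (\<lambda>s. f12 (s, y))" if "a \<le> t" for t
  proof -
    have "((\<lambda>r. integral (cbox a t) (\<lambda>s. f1 (s, r))) has_real_derivative
        integral (cbox a t) (\<lambda>s. f12 (s, y))) (at y within {-d..d})"
    proof (rule leibniz_rule_field_derivative)
      show "continuous_on ({-d..d} \<times> cbox a t) (\<lambda>(r, s). f12 (s, r))"
        by (auto simp: case_prod_unfold strip_def intro!: continuous_on_compose2[OF c12] continuous_intros)
      show "(\<lambda>s. f1 (s, r)) integrable_on cbox a t" if "r \<in> {-d..d}" for r
        by (rule integrable_continuous) (rule continuous_on_strip_slices(1)[OF c1 that])
    qed (use y f12 in \<open>auto intro: has_ddyD\<close>)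
    then have 1: "((\<lambda>r. integral {a..t} (\<lambda>s. f1 (s, r))) has_real_derivative
        integral {a..t} (\<lambda>s. f12 (s, y))) (at y within {-d..d})" by simp
    have 2: "integral {a..t} (\<lambda>s. f1 (s, r)) = f (t, r) - f (a, r)" if "r \<in> {-d..d}" for r
      using integral_ddx[OF f1 \<open>a \<le> t\<close> that] by (rule integral_unique)
    have 3: "((\<lambda>r. f (t, r) - f (a, r)) has_real_derivative
        integral {a..t} (\<lambda>s. f12 (s, y))) (at y within {-d..d})"
      by (rule has_real_derivative_cong_on[OF y _ 1]) (simp add: 2)
    have 4: "((\<lambda>r. f (t, r) - f (a, r)) has_real_derivative f2 (t, y) - f2 (a, y)) (at y within {-d..d})"
      by (intro derivative_intros has_ddyD[OF f2 y])
    show ?thesis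
      using has_real_derivative_unique_within_Icc[OF _ y 4 3] \<open>d > 0\<close> by simp
  qed
  have x: "x \<in> {a..x + 1}" by (simp add: a_def)
  have 1: "((\<lambda>t. integral {a..t} (\<lambda>s. f12 (s, y))) has_real_derivative f12 (x, y)) (at x within {a..x+1})"
    by (rule integral_has_real_derivative[OF continuous_on_strip_slices(1)[OF c12 y] x])
  have "((\<lambda>t. f2 (t, y) - f2 (a, y)) has_real_derivative f12 (x, y)) (at x within {a..x+1})"
    by (rule has_real_derivative_cong_on[OF x _ 1]) (simp add: diff)
  moreover have "((\<lambda>t. f2 (t, y) - f2 (a, y)) has_real_derivative f21 (x, y)) (at x within {a..x+1})"
    using DERIV_diff[OF has_ddxD[OF f21 y, of x] DERIV_const[of "f2 (a, y)"]]
    by (auto intro: has_field_derivative_at_within)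
  ultimately show ?thesis
    using has_real_derivative_unique_within_Icc[OF _ x] by (simp add: a_def)
qed

section \<open>Uniqueness and periodicity of derivatives, reduction to one period\<close>

lemma C1_stripD:
  assumes "C1_strip d f"
  shows "has_ddx d f (ddx f)" "has_ddy d f (ddy d f)"
    "continuous_on (strip d) f" "continuous_on (strip d) (ddx f)" "continuous_on (strip d) (ddy d f)"
  using assms
  by (auto simp: C1_strip_def has_ddx_def has_ddy_def ddx_def ddy_def vector_derivative_works
      has_real_derivative_iff_has_vector_derivative)

lemma has_ddx_cong:
  assumes "has_ddx d f f'" "\<And>p. p \<in> strip d \<Longrightarrow> g p = f p" "\<And>p. p \<in> strip d \<Longrightarrow> g' p = f' p"
  shows "has_ddx d g g'"
  unfolding has_ddx_def
proof (intro allI ballI)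
  fix x y assume y: "y \<in> {-d..d}"
  then have "g (s, y) = f (s, y)" "g' (s, y) = f' (s, y)" for s using assms(2,3) by (auto simp: strip_def)
  then show "((\<lambda>s. g (s, y)) has_real_derivative g' (x, y)) (at x)"
    using has_ddxD[OF assms(1) y] by simp
qed

lemma has_ddy_cong:
  assumes "has_ddy d f f'" "\<And>p. p \<in> strip d \<Longrightarrow> g p = f p" "\<And>p. p \<in> strip d \<Longrightarrow> g' p = f' p"
  shows "has_ddy d g g'"
  unfolding has_ddy_def
proof (intro allI ballI)
  fix x y assume y: "y \<in> {-d..d}"
  have eq: "g (x, s) = f (x, s)" "g' (x, s) = f' (x, s)" if "s \<in> {-d..d}" for s
    using assms(2,3) that by (auto simp: strip_def)
  show "((\<lambda>s. g (x, s)) has_real_derivative g' (x, y)) (at y within {-d..d})"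
    unfolding eq(2)[OF y] by (rule has_real_derivative_cong_on[OF y eq(1) has_ddyD[OF assms(1) y]])
qed

lemma has_ddx_unique:
  assumes "has_ddx d f f'" "has_ddx d f f''" "p \<in> strip d"
  shows "f' p = f'' p"
  using assms DERIV_unique by (fastforce simp: has_ddx_def strip_def)

lemma has_ddy_unique:
  assumes "d > 0" "has_ddy d f f'" "has_ddy d f f''" "p \<in> strip d"
  shows "f' p = f'' p"
proof -
  obtain x y where p: "p = (x, y)" "y \<in> {-d..d}" using assms(4) by (auto simp: strip_def)
  show ?thesis unfolding p(1)
    using has_real_derivative_unique_within_Icc[OF _ p(2) has_ddyD[OF assms(2) p(2)] has_ddyD[OF assms(3) p(2)]]
      \<open>d > 0\<close> by simp
qed

lemma periodic_ddx:
  assumes "periodic_x L d f" "has_ddx d f f'"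
  shows "periodic_x L d f'"
  unfolding periodic_x_def
proof (intro allI ballI)
  fix x y assume y: "y \<in> {-d..d}"
  have "((\<lambda>s. f (s + L, y)) has_real_derivative f' (x + L, y)) (at x)"
    using has_ddxD[OF assms(2) y, of "x + L"] by (simp add: DERIV_shift)
  moreover have "f (s + L, y) = f (s, y)" for s using assms(1) y by (simp add: periodic_x_def)
  ultimately show "f' (x + L, y) = f' (x, y)"
    using has_ddxD[OF assms(2) y, of x] DERIV_unique by simp
qed

lemma periodic_ddy:
  assumes "d > 0" "periodic_x L d f" "has_ddy d f f'"
  shows "periodic_x L d f'"
  unfolding periodic_x_def
proof (intro allI ballI)
  fix x y assume y: "y \<in> {-d..d}"
  have "((\<lambda>s. f (x, s)) has_real_derivative f' (x + L, y)) (at y within {-d..d})"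
    by (rule has_real_derivative_cong_on[OF y _ has_ddyD[OF assms(3) y]])
      (use assms(2) in \<open>simp add: periodic_x_def\<close>)
  then show "f' (x + L, y) = f' (x, y)"
    using has_real_derivative_unique_within_Icc[OF _ y _ has_ddyD[OF assms(3) y]] \<open>d > 0\<close> by simp
qed

lemma periodic_x_reduce:
  assumes "periodic_x L d f" "L > 0" "p \<in> strip d"
  obtains p' where "p' \<in> {0..L} \<times> {-d..d}" "f p' = f p"
proof -
  obtain x y where p: "p = (x, y)" "y \<in> {-d..d}" using assms(3) by (auto simp: strip_def)
  have shift: "f (s + real n * L, y) = f (s, y)" for s n
  proof (induction n)
    case (Suc n)
    have "f ((s + real n * L) + L, y) = f (s + real n * L, y)"
      using assms(1) p(2) unfolding periodic_x_def by blast
    then show ?case using Suc by (simp add: algebra_simps)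
  qed simp
  define n where "n = \<lfloor>x / L\<rfloor>"
  define x' where "x' = x - of_int n * L"
  have "of_int n \<le> x / L" "x / L < of_int n + 1" unfolding n_def by linarith+
  then have "x' \<in> {0..L}" using \<open>L > 0\<close> by (auto simp: x'_def field_simps)
  moreover have "f (x', y) = f (x, y)"
  \<comment> \<open>\<open>shift\<close> only adds periods: for \<open>n \<ge> 0\<close> it leads
    from \<open>x'\<close> to \<open>x\<close>, otherwise from \<open>x\<close> to
    \<open>x'\<close>.\<close>
  proof (cases "n \<ge> 0")
    case True
    then show ?thesis using shift[of x' "nat n"] by (simp add: x'_def)
  next
    case False
    then show ?thesis using shift[of x "nat (-n)"] by (simp add: x'_def)
  qed
  ultimately show ?thesis using that[of "(x', y)"] p by auto
qed

lemma periodic_bounded_image: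
  assumes "L > 0" "periodic_x L d f" "continuous_on (strip d) f"
  shows "bounded (f ` strip d)"
proof -
  have "compact (f ` ({0..L} \<times> {-d..d}))"
    by (rule compact_continuous_image[OF continuous_on_subset[OF assms(3)]])
      (auto simp: strip_def intro: compact_Times)
  moreover have "f ` strip d \<subseteq> f ` ({0..L} \<times> {-d..d})"
    using periodic_x_reduce[OF assms(2,1)] by (metis image_eqI image_subsetI)
  ultimately show ?thesis using bounded_subset compact_imp_bounded by blast
qed

subsection \<open>Quotients that are only continuous at zeros of the denominator\<close>

text \<open>At a zero of \<open>g\<close> the difference quotient of \<open>h * g\<close> is
  \<open>h\<close> times that of \<open>g\<close>, so continuity of \<open>h\<close> replaces
  differentiability.\<close>

lemma has_field_derivative_mult_zero:
  fixes g h :: "real \<Rightarrow> real"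
  assumes g: "(g has_real_derivative g') (at x within S)" and "g x = 0"
    and h: "continuous (at x within S) h"
  shows "((\<lambda>t. h t * g t) has_real_derivative h x * g') (at x within S)"
proof -
  have "((\<lambda>t. (g t - g x) / (t - x)) \<longlongrightarrow> g') (at x within S)"
    using g by (simp add: has_field_derivative_iff)
  then have "((\<lambda>t. h t * ((g t - g x) / (t - x))) \<longlongrightarrow> h x * g') (at x within S)"
    using h by (intro tendsto_mult) (simp_all add: continuous_within)
  then show ?thesis
    using \<open>g x = 0\<close> by (simp add: has_field_derivative_iff)
qed

text \<open>In the next lemmas \<open>q\<close> is the quotient \<open>v / w\<close>, which is only continuous where \<open>w\<close> vanishes.\<close>

lemma has_field_derivative_quotient:
  fixes w v q :: "real \<Rightarrow> real"
  assumes w: "(w has_real_derivative w') (at x within S)"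
    and v: "(v has_real_derivative v') (at x within S)"
    and vq: "\<And>t. t \<in> S \<Longrightarrow> v t = q t * w t" and "x \<in> S" and "w x \<noteq> 0"
  shows "(q has_real_derivative (v' - q x * w') / w x) (at x within S)"
proof -
  have "((\<lambda>t. v t / w t) has_real_derivative (v' - q x * w') / w x) (at x within S)"
    using assms(4,5) vq[of x] by (auto intro!: derivative_eq_intros v w simp: field_simps)
  moreover have "\<forall>\<^sub>F t in at x within S. w t \<noteq> 0"
    using DERIV_continuous[OF w] \<open>w x \<noteq> 0\<close> by (simp add: continuous_within tendsto_imp_eventually_ne)
  then have "\<forall>\<^sub>F t in at x within S. v t / w t = q t"
    using eventually_at_topological vq by (smt (verit) eventually_mono eventually_at nonzero_mult_div_cancel_right)
  ultimately show ?thesis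
    using has_field_derivative_cong_eventually[of "\<lambda>t. v t / w t" q x S] vq[OF \<open>x \<in> S\<close>] \<open>w x \<noteq> 0\<close>
    by simp
qed

text \<open>The product rule at a zero combined with uniqueness of derivatives. It is the reason
  that \<open>Z\<close> vanishes where \<open>w\<close> does.\<close>

lemma derivative_factor_at_zero:
  fixes w v q :: "real \<Rightarrow> real"
  assumes w: "(w has_real_derivative w') (at x within S)" and v: "(v has_real_derivative v') (at x within S)"
    and vq: "\<And>t. t \<in> S \<Longrightarrow> v t = q t * w t" and q: "continuous (at x within S) q"
    and "x \<in> S" "w x = 0" and nontriv: "at x within S \<noteq> bot"
  shows "v' = q x * w'"
proof -
  have "((\<lambda>t. q t * w t) has_real_derivative q x * w') (at x within S)"
    by (rule has_field_derivative_mult_zero[OF w \<open>w x = 0\<close> q])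
  then have "(v has_real_derivative q x * w') (at x within S)"
    by (rule has_real_derivative_cong_on[OF \<open>x \<in> S\<close>, rotated]) (simp add: vq)
  then show ?thesis
    using v nontriv tendsto_unique unfolding has_field_derivative_iff by blast
qed

text \<open>Where \<open>w\<close> is nonzero, \<open>q' * v = q * (v' - q * w')\<close>; the
  resulting formula no longer divides by \<open>w\<close> and persists at its zeros. It serves the
  Hardy flux.\<close>

lemma has_field_derivative_quotient_mult:
  fixes w v q :: "real \<Rightarrow> real"
  assumes w: "(w has_real_derivative w') (at x within S)"
    and v: "(v has_real_derivative v') (at x within S)"
    and vq: "\<And>t. t \<in> S \<Longrightarrow> v t = q t * w t" and q: "continuous (at x within S) q"
    and "x \<in> S" and nontriv: "at x within S \<noteq> bot"
  shows "((\<lambda>t. q t * v t) has_real_derivative 2 * q x * v' - (q x)\<^sup>2 * w') (at x within S)"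
proof (cases "w x = 0")
  case True
  have "v' = q x * w'" by (rule derivative_factor_at_zero[OF w v vq q \<open>x \<in> S\<close> True nontriv])
  moreover have "((\<lambda>t. q t * v t) has_real_derivative q x * v') (at x within S)"
    by (rule has_field_derivative_mult_zero[OF v _ q]) (use True vq \<open>x \<in> S\<close> in simp)
  ultimately show ?thesis by (simp add: power2_eq_square algebra_simps)
next
  case False
  show ?thesis
    using vq[OF \<open>x \<in> S\<close>] False
    by (auto intro!: derivative_eq_intros v has_field_derivative_quotient[OF w v vq \<open>x \<in> S\<close> False]
        simp: field_simps power2_eq_square)
qed

text \<open>Composed with \<open>w\<close>, the value \<open>a = 0\<close> restricts to the region
  \<open>w < 0\<close> and \<open>a = 1\<close> means no cut-off, so one flux computation covers
  both uses.\<close>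

definition cut :: "real \<Rightarrow> real \<Rightarrow> real" where
  "cut a t = (if t < 0 then 1 else a)"

text \<open>Away from zeros of \<open>w\<close> the cut-off is locally constant and
  \<open>v * q' = q * (v' - q * w')\<close> completes the square. At a zero both \<open>v\<close>
  and \<open>v' - q * w'\<close> vanish, so the jump is harmless and the derivative is zero.\<close>

lemma has_field_derivative_cut_flux:
  fixes w v q :: "real \<Rightarrow> real"
  assumes w: "(w has_real_derivative w' x) (at x within S)"
    and v: "(v has_real_derivative v' x) (at x within S)"
    and w': "(w' has_real_derivative w'') (at x within S)"
    and v': "(v' has_real_derivative v'') (at x within S)"
    and vq: "\<And>t. t \<in> S \<Longrightarrow> v t = q t * w t" and q: "continuous (at x within S) q"
    and "x \<in> S" and nontriv: "at x within S \<noteq> bot"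
  shows "((\<lambda>t. cut a (w t) * v t * (v' t - q t * w' t)) has_real_derivative
      cut a (w x) * ((v' x - q x * w' x)\<^sup>2 + v x * (v'' - q x * w''))) (at x within S)"
proof (cases "w x = 0")
  case True
  have Z0: "v' x - q x * w' x = 0"
    using derivative_factor_at_zero[OF w v vq q] assms(7,8) True by simp
  have "((\<lambda>t. v' t - q t * w' t) \<longlongrightarrow> v' x - q x * w' x) (at x within S)"
    using DERIV_continuous[OF v'] DERIV_continuous[OF w'] q
    by (intro tendsto_intros) (auto simp: continuous_within)
  then have "((\<lambda>t. cut a (w t) * (v' t - q t * w' t)) \<longlongrightarrow> 0) (at x within S)"
    unfolding Z0
  proof (rule Lim_null_comparison[rotated, OF tendsto_mult_right_zero[OF tendsto_rabs_zero]])
    show "\<forall>\<^sub>F t in at x within S. norm (cut a (w t) * (v' t - q t * w' t)) \<le> (1 + \<bar>a\<bar>) * \<bar>v' t - q t * w' t\<bar>"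
      by (intro always_eventually allI) (auto simp: cut_def abs_mult distrib_right)
  qed
  then have "continuous (at x within S) (\<lambda>t. cut a (w t) * (v' t - q t * w' t))"
    using Z0 by (simp add: continuous_within)
  from has_field_derivative_mult_zero[OF v _ this] show ?thesis
    using Z0 True vq[OF \<open>x \<in> S\<close>] by (simp add: mult_ac)
next
  case False
  have "((\<lambda>t. cut a (w x) * v t * (v' t - q t * w' t)) has_real_derivative
      cut a (w x) * ((v' x - q x * w' x)\<^sup>2 + v x * (v'' - q x * w''))) (at x within S)"
    using vq[OF \<open>x \<in> S\<close>] False
    by (auto intro!: derivative_eq_intros v v' w' has_field_derivative_quotient[OF w v vq \<open>x \<in> S\<close> False]
        simp: field_simps power2_eq_square)
  moreover have "\<forall>\<^sub>F t in at x within S. cut a (w t) = cut a (w x)"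
  proof -
    have lim: "(w \<longlongrightarrow> w x) (at x within S)" using DERIV_continuous[OF w] by (simp add: continuous_within)
    show ?thesis
    proof (cases "w x < 0")
      case True
      show ?thesis using order_tendstoD(2)[OF lim True] by eventually_elim (use True in \<open>simp add: cut_def\<close>)
    next
      case False
      with \<open>w x \<noteq> 0\<close> have "0 < w x" by simp
      show ?thesis using order_tendstoD(1)[OF lim \<open>0 < w x\<close>] by eventually_elim (use \<open>0 < w x\<close> in \<open>simp add: cut_def\<close>)
    qed
  qed
  then have "\<forall>\<^sub>F t in at x within S.
      cut a (w x) * v t * (v' t - q t * w' t) = cut a (w t) * v t * (v' t - q t * w' t)"
    by eventually_elim simp
  ultimately show ?thesis
    using has_field_derivative_cong_eventually by fastforce
qed

text \<open>The jump sits where \<open>f\<close> vanishes, so two continuous pieces can be pasted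
  along \<open>w = 0\<close>.\<close>

lemma continuous_on_cut:
  fixes w f :: "'a::topological_space \<Rightarrow> real"
  assumes w: "continuous_on S w" and f: "continuous_on S f"
    and zero: "\<And>p. p \<in> S \<Longrightarrow> w p = 0 \<Longrightarrow> f p = 0"
  shows "continuous_on S (\<lambda>p. cut a (w p) * f p)"
proof -
  have "continuous_on S (\<lambda>p. if w p \<le> 0 then f p else a * f p)"
    by (rule continuous_on_cases_le)
      (use zero in \<open>auto intro!: continuous_intros continuous_on_subset[OF f] continuous_on_subset[OF w]\<close>)
  then show ?thesis
    by (rule continuous_on_eq) (use zero in \<open>auto simp: cut_def\<close>)
qed

subsection \<open>Elementary inequalities\<close>

text \<open>Propagates negativity along a line although \<open>f'\<close> is known to vanish only
  where \<open>f\<close> is negative.\<close>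

lemma negative_on_interval:
  fixes f :: "real \<Rightarrow> real"
  assumes f: "\<And>x. x \<in> {a..b} \<Longrightarrow> (f has_real_derivative f' x) (at x within {a..b})"
    and stat: "\<And>x. x \<in> {a..b} \<Longrightarrow> f x < 0 \<Longrightarrow> f' x = 0"
    and x0: "x0 \<in> {a..b}" "f x0 < 0" and x: "x \<in> {a..b}"
  shows "f x < 0"
proof -
  \<comment> \<open>The square of the negative part of \<open>f\<close>: its derivative is zero
    everywhere, including at zeros of \<open>f\<close>, so it is constant.\<close>
  define m where "m = (\<lambda>t. min (f t) 0 * f t)"
  have "\<exists>c. \<forall>t\<in>{a..b}. m t = c"
  proof (rule has_field_derivative_zero_constant)
    fix t assume t: "t \<in> {a..b}"
    have lim: "(f \<longlongrightarrow> f t) (at t within {a..b})"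
      using DERIV_continuous[OF f[OF t]] by (simp add: continuous_within)
    consider "f t < 0" | "f t = 0" | "f t > 0" by linarith
    then show "(m has_real_derivative 0) (at t within {a..b})"
    proof cases
      case 1
      have "\<forall>\<^sub>F s in at t within {a..b}. (f s)\<^sup>2 = m s"
        using order_tendstoD(2)[OF lim 1] by eventually_elim (simp add: m_def power2_eq_square)
      moreover have "((\<lambda>s. (f s)\<^sup>2) has_real_derivative 0) (at t within {a..b})"
        using stat[OF t 1] by (auto intro!: derivative_eq_intros f[OF t])
      ultimately show ?thesis
        using has_field_derivative_cong_eventually[of "\<lambda>s. (f s)\<^sup>2" m t "{a..b}"] 1
        by (simp add: m_def power2_eq_square)
    next
      case 2
      have "((\<lambda>s. min (f s) 0) \<longlongrightarrow> min (f t) 0) (at t within {a..b})"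
        by (intro tendsto_intros lim)
      then show ?thesis
        using has_field_derivative_mult_zero[OF f[OF t] 2, of "\<lambda>s. min (f s) 0"] 2
        by (simp add: m_def continuous_within)
    next
      case 3
      have "\<forall>\<^sub>F s in at t within {a..b}. 0 = m s"
        using order_tendstoD(1)[OF lim 3] by eventually_elim (simp add: m_def)
      then show ?thesis
        using has_field_derivative_cong_eventually[of "\<lambda>s. 0" m t "{a..b}" 0] 3
        by (simp add: m_def)
    qed
  qed simp
  then have "m x = m x0" using x x0(1) by metis
  moreover have "m x0 > 0" using x0(2) by (simp add: m_def mult_neg_neg)
  ultimately show ?thesis by (cases "f x" "0 :: real" rule: linorder_cases) (simp_all add: m_def)
qed

text \<open>For \<open>g = e v\<close> with a weight \<open>e\<close> depending on \<open>y\<close> only, \<open>e' = \<psi> e\<close> and \<open>\<psi>' = \<tau>\<close>, one has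
  \<open>g\<^sub>y = e a\<close> and \<open>e \<Delta>v = e (S + B)\<close> with \<open>S\<close> symmetric and \<open>B\<close> antisymmetric. The right-hand side is
  \<open>e\<^sup>-\<^sup>2\<close> times the divergence of the flux that arises on integrating \<open>- 2 e\<^sup>2 S B\<close> by parts.\<close>

lemma carleman_pointwise:
  fixes v v1 v2 v11 v12 v22 \<psi> \<tau> a a' :: real
  assumes "a = v2 + \<psi> * v" "a' = v22 + \<psi> * v2 + \<tau> * v"
  shows "4 * \<tau> * a\<^sup>2 + 4 * \<tau> * \<psi>\<^sup>2 * v\<^sup>2 - (v11 + v22)\<^sup>2 \<le>
      4 * \<psi> * v11 * a + 4 * \<psi> * v1 * (v12 + \<psi> * v1) + 2 * \<tau> * v1\<^sup>2 + 2 * \<tau> * v * v11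
    + 2 * \<psi> * (2 * \<psi> * a\<^sup>2 + 2 * \<tau> * v * a - 2 * \<psi> * v1\<^sup>2 + 2 * \<psi>^3 * v\<^sup>2)
    + (2 * \<tau> * a\<^sup>2 + 4 * \<psi> * a * a' + 2 * \<tau> * v2 * a + 2 * \<tau> * v * a' - 2 * \<tau> * v1\<^sup>2
       - 4 * \<psi> * v1 * v12 + 6 * \<psi>\<^sup>2 * \<tau> * v\<^sup>2 + 4 * \<psi>^3 * v * v2)" (is "?l \<le> ?r")
proof -
  define S where "S = a' + \<psi> * a + v11 + \<psi>\<^sup>2 * v"
  define B where "B = - 2 * \<psi> * a - \<tau> * v"
  \<comment> \<open>The two squares are the gain of the commutator. With the splitting of the
    Laplacian, \<open>?r - ?l\<close> becomes the sum of the squares of \<open>S\<close> and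
    \<open>B\<close>.\<close>
  have "?r = 4 * \<tau> * a\<^sup>2 + 4 * \<tau> * \<psi>\<^sup>2 * v\<^sup>2 - 2 * S * B"
    unfolding S_def B_def assms by algebra
  moreover have "v11 + v22 = S + B"
    unfolding S_def B_def assms by algebra
  then have "(v11 + v22)\<^sup>2 = S\<^sup>2 + B\<^sup>2 + 2 * S * B" by (simp add: power2_sum)
  moreover have "S\<^sup>2 \<ge> 0" "B\<^sup>2 \<ge> 0" by simp_all
  ultimately show ?thesis by linarith
qed

text \<open>The right-hand side is \<open>- e\<^sup>-\<^sup>2 (e\<^sup>2 w\<^sub>y q v)\<^sub>y\<close>.\<close>

lemma hardy_pointwise:
  fixes w q v a w2 w22 M \<delta> :: real
  assumes "\<delta> > 0" "\<delta> \<le> w2\<^sup>2 + w\<^sup>2" "\<bar>w22\<bar> \<le> M" "v = q * w"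
  shows "\<delta> / 4 * q\<^sup>2 - 2 * a\<^sup>2 - (1 / 2 + M\<^sup>2 / \<delta>) * v\<^sup>2 \<le> (w2 * q)\<^sup>2 - 2 * w2 * q * a - w22 * q * v"
proof -
  \<comment> \<open>Young's inequality, weighted so that half of the square of \<open>w2 * q\<close>
    and a quarter of \<open>\<delta>\<close> times the square of \<open>q\<close> are spent; a
    quarter of the latter survives.\<close>
  have "0 \<le> (w2 * q - 2 * a)\<^sup>2" by simp
  then have 1: "2 * w2 * q * a \<le> (w2 * q)\<^sup>2 / 2 + 2 * a\<^sup>2" by (simp add: power2_diff power2_eq_square algebra_simps)
  have 2: "w22 * q * v \<le> \<delta> / 4 * q\<^sup>2 + M\<^sup>2 / \<delta> * v\<^sup>2"
  proof -
    have "w22 * q * v \<le> M * \<bar>q * v\<bar>"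
      using mult_right_mono[OF assms(3), of "\<bar>q * v\<bar>"] abs_ge_self[of "w22 * (q * v)"]
      by (simp add: abs_mult mult.assoc)
    moreover have "0 \<le> (\<delta> / 2 * \<bar>q\<bar> - M * \<bar>v\<bar>)\<^sup>2 / \<delta>" using \<open>\<delta> > 0\<close> by simp
    then have "M * \<bar>q * v\<bar> \<le> \<delta> / 4 * q\<^sup>2 + M\<^sup>2 / \<delta> * v\<^sup>2"
      using \<open>\<delta> > 0\<close> by (simp add: power2_diff power_mult_distrib power_divide abs_mult field_simps power2_eq_square)
    ultimately show ?thesis by linarith
  qed
  have "\<delta> * q\<^sup>2 \<le> (w2 * q)\<^sup>2 + v\<^sup>2"
    using mult_right_mono[OF assms(2), of "q\<^sup>2"] by (simp add: assms(4) power_mult_distrib algebra_simps)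
  with 1 2 show ?thesis by (simp add: algebra_simps)
qed

subsection \<open>The energy identity\<close>

text \<open>What remains after eliminating the pressure, in the frame moving with the wave. Indices
  1 and 2 denote derivatives in x and y, and \<open>v12\<close> is the common mixed derivative of
  \<open>v\<close>. For \<open>q\<close> only continuity is available, because it is a quotient of
  second-order expressions.\<close>

locale steady_wave =
  fixes L d \<beta> :: real
    and w v q w1 w2 v1 v2 w11 w22 v11 v12 v22 :: "real \<times> real \<Rightarrow> real"
  assumes L_pos: "L > 0" and d_pos: "d > 0" and \<beta>_nonneg: "\<beta> \<ge> 0"
    and w1: "has_ddx d w w1" and w2: "has_ddy d w w2"
    and w11: "has_ddx d w1 w11" and w22: "has_ddy d w2 w22"
    and v1: "has_ddx d v v1" and v2: "has_ddy d v v2"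
    and v11: "has_ddx d v1 v11" and v22: "has_ddy d v2 v22"
    and v12: "has_ddy d v1 v12" and v21: "has_ddx d v2 v12"
    and cont: "continuous_on (strip d) w" "continuous_on (strip d) v" "continuous_on (strip d) q"
      "continuous_on (strip d) w1" "continuous_on (strip d) w2"
      "continuous_on (strip d) v1" "continuous_on (strip d) v2"
      "continuous_on (strip d) w11" "continuous_on (strip d) w22"
      "continuous_on (strip d) v11" "continuous_on (strip d) v12" "continuous_on (strip d) v22"
    and per: "periodic_x L d w" "periodic_x L d v" "periodic_x L d q"
      "periodic_x L d w1" "periodic_x L d v1" "periodic_x L d v2"
    and boundary: "\<And>x. v (x, -d) = 0" "\<And>x. v (x, d) = 0"
    and incompressible: "\<And>p. p \<in> strip d \<Longrightarrow> v2 p = - w1 p"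
    and factor: "\<And>p. p \<in> strip d \<Longrightarrow> v p = q p * w p"
    and vorticity: "\<And>p. p \<in> strip d \<Longrightarrow> v11 p + v22 p = (w11 p + w22 p - \<beta>) * q p"
begin

lemma in_strip: "y \<in> {-d..d} \<Longrightarrow> (x, y) \<in> strip d"
  by (simp add: strip_def)

lemma at_y_nontrivial: "y \<in> {-d..d} \<Longrightarrow> at y within {-d..d} \<noteq> bot"
  using d_pos by (simp add: trivial_limit_within islimpt_Icc)

lemma slice_continuous_x: "y \<in> {-d..d} \<Longrightarrow> continuous (at x) (\<lambda>s. q (s, y))"
  using continuous_on_strip_slices(1)[OF cont(3), of y UNIV]
  by (simp add: continuous_on_eq_continuous_at)

lemma slice_continuous_y: "y \<in> {-d..d} \<Longrightarrow> continuous (at y within {-d..d}) (\<lambda>s. q (x, s))"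
  using continuous_on_strip_slices(2)[OF cont(3), of "{-d..d}" x]
  by (simp add: continuous_on_eq_continuous_within)

lemma gradient_factor_at_zero:
  assumes "p \<in> strip d" "w p = 0"
  shows "v1 p = q p * w1 p" "v2 p = q p * w2 p"
proof -
  obtain x y where p: "p = (x, y)" "y \<in> {-d..d}" using assms(1) by (auto simp: strip_def)
  show "v1 p = q p * w1 p"
    using derivative_factor_at_zero[OF has_ddxD[OF w1 p(2)] has_ddxD[OF v1 p(2)] _ slice_continuous_x[OF p(2)]]
      p assms factor in_strip by simp
  show "v2 p = q p * w2 p"
    using derivative_factor_at_zero[OF has_ddyD[OF w2 p(2)] has_ddyD[OF v2 p(2)] _ slice_continuous_y[OF p(2)]]
      p assms factor in_strip at_y_nontrivial by simp
qed

lemma v1_boundary: "v1 (x, -d) = 0" "v1 (x, d) = 0"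
  using has_ddxD[OF v1, of "-d" x] has_ddxD[OF v1, of d x] d_pos
  by (auto simp: boundary intro: DERIV_unique[OF _ DERIV_const])

abbreviation Z1 where "Z1 p \<equiv> v1 p - q p * w1 p"
abbreviation Z2 where "Z2 p \<equiv> v2 p - q p * w2 p"

text \<open>The flux is \<open>v * Z\<close>, possibly cut off. In its divergence the vorticity
  equation leaves \<open>- \<beta> * q\<close> for the Laplacian of \<open>v\<close> minus
  \<open>q\<close> times that of \<open>w\<close>, and \<open>v = q * w\<close> does the
  rest.\<close>

lemma cut_flux:
  fixes a :: real
  defines "F \<equiv> \<lambda>p. cut a (w p) * v p * Z1 p" and "G \<equiv> \<lambda>p. cut a (w p) * v p * Z2 p"
    and "F' \<equiv> \<lambda>p. cut a (w p) * ((Z1 p)\<^sup>2 + v p * (v11 p - q p * w11 p))"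
    and "G' \<equiv> \<lambda>p. cut a (w p) * ((Z2 p)\<^sup>2 + v p * (v22 p - q p * w22 p))"
  shows "has_ddx d F F'" "continuous_on (strip d) F'" "periodic_x L d F"
    and "has_ddy d G G'" "continuous_on (strip d) G'" "G (x, -d) = 0" "G (x, d) = 0"
    and "\<And>p. p \<in> strip d \<Longrightarrow>
      F' p + G' p = cut a (w p) * ((Z1 p)\<^sup>2 + (Z2 p)\<^sup>2 - \<beta> * w p * (q p)\<^sup>2)"
proof -
  show "has_ddx d F F'"
    unfolding has_ddx_def F_def F'_def
  proof (intro allI ballI)
    fix x y assume y: "y \<in> {-d..d}"
    show "((\<lambda>s. cut a (w (s, y)) * v (s, y) * Z1 (s, y)) has_real_derivative
        cut a (w (x, y)) * ((Z1 (x, y))\<^sup>2 + v (x, y) * (v11 (x, y) - q (x, y) * w11 (x, y)))) (at x)"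
      using has_field_derivative_cut_flux[OF has_ddxD[OF w1 y] has_ddxD[OF v1 y] has_ddxD[OF w11 y]
          has_ddxD[OF v11 y] _ slice_continuous_x[OF y]] factor[OF in_strip[OF y]] by simp
  qed
  show "has_ddy d G G'"
    unfolding has_ddy_def G_def G'_def
  proof (intro allI ballI)
    fix x y assume y: "y \<in> {-d..d}"
    show "((\<lambda>s. cut a (w (x, s)) * v (x, s) * Z2 (x, s)) has_real_derivative
        cut a (w (x, y)) * ((Z2 (x, y))\<^sup>2 + v (x, y) * (v22 (x, y) - q (x, y) * w22 (x, y))))
        (at y within {-d..d})"
      by (rule has_field_derivative_cut_flux[OF has_ddyD[OF w2 y] has_ddyD[OF v2 y] has_ddyD[OF w22 y]
          has_ddyD[OF v22 y] factor[OF in_strip] slice_continuous_y[OF y] y at_y_nontrivial[OF y]])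
  qed
  show "continuous_on (strip d) F'" "continuous_on (strip d) G'"
    unfolding F'_def G'_def
    by (rule continuous_on_cut; use cont gradient_factor_at_zero factor in \<open>auto intro!: continuous_intros\<close>)+
  show "periodic_x L d F" using per by (simp add: F_def periodic_x_def)
  show "G (x, -d) = 0" "G (x, d) = 0" by (simp_all add: G_def boundary)
  fix p assume p: "p \<in> strip d"
  have "F' p + G' p = cut a (w p) * ((Z1 p)\<^sup>2 + (Z2 p)\<^sup>2
      + v p * ((v11 p + v22 p) - q p * (w11 p + w22 p)))"
    unfolding F'_def G'_def by (simp add: algebra_simps)
  also have "v p * ((v11 p + v22 p) - q p * (w11 p + w22 p)) = - \<beta> * w p * (q p)\<^sup>2"
    unfolding vorticity[OF p] factor[OF p] by (simp add: algebra_simps power2_eq_square)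
  finally show "F' p + G' p = cut a (w p) * ((Z1 p)\<^sup>2 + (Z2 p)\<^sup>2 - \<beta> * w p * (q p)\<^sup>2)" by simp
qed

lemma rect_in_strip: "p \<in> {0..L} \<times> {-d..d} \<Longrightarrow> p \<in> strip d"
  by (auto simp: strip_def)

text \<open>Since \<open>v = 0\<close> on the walls, the cut-off flux has zero total divergence; a
  pointwise sign therefore forces it to vanish.\<close>

lemma cut_energy_vanishes:
  assumes "p \<in> {0..L} \<times> {-d..d}"
    and pos: "\<And>p. p \<in> {0..L} \<times> {-d..d} \<Longrightarrow>
      0 \<le> cut a (w p) * ((Z1 p)\<^sup>2 + (Z2 p)\<^sup>2 - \<beta> * w p * (q p)\<^sup>2)"
  shows "cut a (w p) * ((Z1 p)\<^sup>2 + (Z2 p)\<^sup>2 - \<beta> * w p * (q p)\<^sup>2) = 0"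
proof (rule vanishing_from_divergence[OF L_pos d_pos cut_flux(1-5)[of a] _ _ _ assms(1)])
  show "continuous_on (strip d) (\<lambda>p. cut a (w p) * ((Z1 p)\<^sup>2 + (Z2 p)\<^sup>2 - \<beta> * w p * (q p)\<^sup>2))"
    by (rule continuous_on_cut; use cont gradient_factor_at_zero in \<open>auto intro!: continuous_intros\<close>)
  show "cut a (w (x, d)) * v (x, d) * Z2 (x, d) \<le> cut a (w (x, -d)) * v (x, -d) * Z2 (x, -d)" for x
    by (simp add: boundary)
  show "0 \<le> cut a (w p) * ((Z1 p)\<^sup>2 + (Z2 p)\<^sup>2 - \<beta> * w p * (q p)\<^sup>2)
      \<and> cut a (w p) * ((Z1 p)\<^sup>2 + (Z2 p)\<^sup>2 - \<beta> * w p * (q p)\<^sup>2)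
        \<le> cut a (w p) * ((Z1 p)\<^sup>2 + v p * (v11 p - q p * w11 p))
          + cut a (w p) * ((Z2 p)\<^sup>2 + v p * (v22 p - q p * w22 p))"
    if "p \<in> {0..L} \<times> {-d..d}" for p
    using pos[OF that] cut_flux(8)[OF rect_in_strip[OF that], of a] by simp
qed

section \<open>Vanishing of \<open>v\<close> when \<beta> = 0 or when \<open>w\<close> is
  large\<close>

lemma v_vanishes_if_beta_zero:
  assumes "\<beta> = 0" and p: "p \<in> {0..L} \<times> {-d..d}"
  shows "v p = 0"
proof -
  have Z: "Z1 p = 0 \<and> Z2 p = 0" if "p \<in> {0..L} \<times> {-d..d}" for p
  proof -
    have "cut 1 (w p) * ((Z1 p)\<^sup>2 + (Z2 p)\<^sup>2 - \<beta> * w p * (q p)\<^sup>2) = 0"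
      using that by (rule cut_energy_vanishes) (simp add: \<open>\<beta> = 0\<close> cut_def)
    then show ?thesis
      using sum_power2_eq_zero_iff[of "Z1 p" "Z2 p"] \<open>\<beta> = 0\<close> by (auto simp: cut_def split: if_splits)
  qed
  \<comment> \<open>Once \<open>v1 = q * w1\<close> and \<open>v2 = - w1\<close>, the field
    \<open>(v * w, v^2)\<close> is divergence free, so the factor y contributes exactly
    \<open>v^2\<close>.\<close>
  define F where "F p = snd p * (v p * w p)" for p
  define F' where "F' p = snd p * (v1 p * w p + v p * w1 p)" for p
  define G where "G p = snd p * (v p)\<^sup>2" for p
  define G' where "G' p = (v p)\<^sup>2 + snd p * (2 * v p * v2 p)" for p
  have "(v p)\<^sup>2 = 0"
  proof (rule vanishing_from_divergence[OF L_pos d_pos, where F=F and F'=F' and G=G and G'=G'])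
    show "has_ddx d F F'" unfolding has_ddx_def F_def F'_def
      by (auto intro!: derivative_eq_intros has_ddxD[OF v1] has_ddxD[OF w1] simp: algebra_simps)
    show "has_ddy d G G'" unfolding has_ddy_def G_def G'_def
      by (auto intro!: derivative_eq_intros has_ddyD[OF v2] simp: algebra_simps power2_eq_square)
    show "continuous_on (strip d) F'" "continuous_on (strip d) G'" "continuous_on (strip d) (\<lambda>p. (v p)\<^sup>2)"
      unfolding F'_def G'_def by (intro continuous_intros cont)+
    show "periodic_x L d F" using per by (simp add: F_def periodic_x_def)
    show "G (x, d) \<le> G (x, -d)" for x by (simp add: G_def boundary)
    fix p assume p: "p \<in> {0..L} \<times> {-d..d}"
    have "v1 p = q p * w1 p" "v2 p = - w1 p" "v p = q p * w p"
      using Z[OF p] factor incompressible rect_in_strip[OF p] by auto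
    then have "F' p + G' p = (v p)\<^sup>2"
      unfolding F'_def G'_def by (simp add: algebra_simps power2_eq_square)
    then show "0 \<le> (v p)\<^sup>2 \<and> (v p)\<^sup>2 \<le> F' p + G' p" by simp
  qed (rule p)
  then show ?thesis by simp
qed

text \<open>Since \<open>k < \<pi> / (2 d)\<close>, the function \<open>k tan (k y)\<close> is smooth on \<open>[-d, d]\<close>, and
  \<open>q\<^sub>y\<^sup>2 - k\<^sup>2 q\<^sup>2 = (q\<^sub>y + k tan (k y) q)\<^sup>2 - (k tan (k y) q\<^sup>2)\<^sub>y\<close>.\<close>

lemma v_vanishes_if_w_large:
  assumes a: "a > 0" "\<And>p. p \<in> strip d \<Longrightarrow> a \<le> w p" and b: "\<And>p. p \<in> strip d \<Longrightarrow> w p \<le> b"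
    and k: "0 < k" "k * d < pi / 2" and ineq: "\<beta> * b < a\<^sup>2 * k\<^sup>2"
    and p: "p \<in> {0..L} \<times> {-d..d}"
  shows "v p = 0"
proof -
  \<comment> \<open>The margin in \<open>ineq\<close>, which is the coefficient of
    \<open>q^2\<close> left at the end.\<close>
  define \<mu> where "\<mu> = a\<^sup>2 * k\<^sup>2 - \<beta> * b"
  have \<mu>: "\<mu> > 0" using ineq by (simp add: \<mu>_def)
  define T where "T p = k * tan (k * snd p) * (q p)\<^sup>2" for p
  define T' where "T' p = k\<^sup>2 * (1 + (tan (k * snd p))\<^sup>2) * (q p)\<^sup>2
      + 2 * k * tan (k * snd p) * q p * (Z2 p / w p)" for p
  have cos: "cos (k * y) > 0" if "y \<in> {-d..d}" for y
  proof (rule cos_gt_zero_pi)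
    have "\<bar>k * y\<bar> \<le> k * d" using that k(1) by (auto simp: abs_mult intro!: mult_left_mono)
    then show "- (pi / 2) < k * y" "k * y < pi / 2" using k(2) by linarith+
  qed
  have w_pos: "w p > 0" if "p \<in> strip d" for p using a(1) a(2)[OF that] by linarith
  have q2: "((\<lambda>s. q (x, s)) has_real_derivative Z2 (x, y) / w (x, y)) (at y within {-d..d})"
    if "y \<in> {-d..d}" for x y
    using w_pos[OF in_strip[OF that], of x]
    by (intro has_field_derivative_quotient[OF has_ddyD[OF w2 that] has_ddyD[OF v2 that] factor[OF in_strip] that])
      auto
  have T: "has_ddy d T T'" unfolding has_ddy_def
  proof (intro allI ballI)
    fix x y :: real assume y: "y \<in> {-d..d}"
    have "((\<lambda>s. tan (k * s)) has_real_derivative k * (1 + (tan (k * y))\<^sup>2)) (at y within {-d..d})"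
      using cos[OF y] tan_sec[of "k * y"]
      by (auto intro!: derivative_eq_intros simp: power_inverse)
    note tan' = this
    show "((\<lambda>s. T (x, s)) has_real_derivative T' (x, y)) (at y within {-d..d})"
      unfolding T_def T'_def fst_conv snd_conv
      by (rule DERIV_cong[OF DERIV_mult[OF DERIV_cmult[OF tan'] DERIV_power[OF q2[OF y]]]])
        (simp add: power2_eq_square algebra_simps)
  qed
  have T'_cont: "continuous_on (strip d) T'"
  proof -
    have "w p \<noteq> 0" and nz: "cos (k * snd p) \<noteq> 0" if "p \<in> strip d" for p
      using w_pos[OF that] cos[of "snd p"] that by (auto simp: strip_def)
    moreover have "continuous_on (strip d) (\<lambda>p. tan (k * snd p))"
      unfolding tan_def by (intro continuous_intros ballI nz)
    ultimately show ?thesis unfolding T'_def by (auto intro!: continuous_intros cont)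
  qed
  \<comment> \<open>Dirichlet condition for the Poincare argument: as \<open>w > 0\<close>,
    \<open>q\<close> inherits the zeros of \<open>v\<close>, and \<open>T\<close> has no flux
    through the walls.\<close>
  have q_boundary: "q (x, -d) = 0" "q (x, d) = 0" for x
    using factor[OF in_strip, of "-d" x] factor[OF in_strip, of d x]
      w_pos[OF in_strip, of "-d" x] w_pos[OF in_strip, of d x] boundary[of x] d_pos by simp_all
  define F where "F p = cut 1 (w p) * v p * Z1 p" for p
  define F' where "F' p = cut 1 (w p) * ((Z1 p)\<^sup>2 + v p * (v11 p - q p * w11 p))" for p
  define G where "G p = cut 1 (w p) * v p * Z2 p" for p
  define G' where "G' p = cut 1 (w p) * ((Z2 p)\<^sup>2 + v p * (v22 p - q p * w22 p))" for p
  note flux = cut_flux[where a=1, folded F_def F'_def G_def G'_def]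
  have "\<mu> * (q p)\<^sup>2 = 0"
  proof (rule vanishing_from_divergence[OF L_pos d_pos flux(1-3)])
    show "has_ddy d (\<lambda>p. G p + a\<^sup>2 * T p) (\<lambda>p. G' p + a\<^sup>2 * T' p)"
      using flux(4) T unfolding has_ddy_def by (auto intro!: derivative_eq_intros)
    show "continuous_on (strip d) (\<lambda>p. G' p + a\<^sup>2 * T' p)" "continuous_on (strip d) (\<lambda>p. \<mu> * (q p)\<^sup>2)"
      by (intro continuous_intros cont flux(5) T'_cont)+
    show "G (x, d) + a\<^sup>2 * T (x, d) \<le> G (x, - d) + a\<^sup>2 * T (x, - d)" for x
      by (simp add: flux(6,7) T_def q_boundary)
    fix p assume "p \<in> {0..L} \<times> {-d..d}"
    then have p: "p \<in> strip d" by (rule rect_in_strip)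
    let ?r = "Z2 p / w p" let ?t = "k * tan (k * snd p)"
    have "Z2 p = w p * ?r" using w_pos[OF p] by simp
    then have "(Z2 p)\<^sup>2 = (w p)\<^sup>2 * ?r\<^sup>2" by (metis power_mult_distrib)
    moreover have "a\<^sup>2 * ?r\<^sup>2 \<le> (w p)\<^sup>2 * ?r\<^sup>2"
      using a p by (intro mult_right_mono power_mono) auto
    moreover have "a\<^sup>2 * (?r\<^sup>2 + T' p - k\<^sup>2 * (q p)\<^sup>2) = a\<^sup>2 * (?r + ?t * q p)\<^sup>2"
      unfolding T'_def by (simp add: algebra_simps power2_eq_square)
    then have "a\<^sup>2 * (?r\<^sup>2 + T' p - k\<^sup>2 * (q p)\<^sup>2) \<ge> 0"
      by (simp only: mult_nonneg_nonneg zero_le_power2)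
    then have "a\<^sup>2 * k\<^sup>2 * (q p)\<^sup>2 \<le> a\<^sup>2 * ?r\<^sup>2 + a\<^sup>2 * T' p" by (simp add: algebra_simps)
    moreover have "\<beta> * w p * (q p)\<^sup>2 \<le> \<beta> * b * (q p)\<^sup>2"
      using b[OF p] \<beta>_nonneg by (intro mult_right_mono mult_left_mono) auto
    moreover have "F' p + G' p = (Z1 p)\<^sup>2 + (Z2 p)\<^sup>2 - \<beta> * w p * (q p)\<^sup>2"
      using flux(8)[OF p] by (simp add: cut_def)
    moreover have "\<mu> * (q p)\<^sup>2 = a\<^sup>2 * k\<^sup>2 * (q p)\<^sup>2 - \<beta> * b * (q p)\<^sup>2"
      by (simp add: \<mu>_def left_diff_distrib)
    moreover have "(Z1 p)\<^sup>2 \<ge> 0" "\<mu> * (q p)\<^sup>2 \<ge> 0" using \<mu> by simp_all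
    ultimately show "0 \<le> \<mu> * (q p)\<^sup>2 \<and> \<mu> * (q p)\<^sup>2 \<le> F' p + (G' p + a\<^sup>2 * T' p)"
      by linarith
  qed (rule p)
  then show ?thesis using \<mu> factor[OF rect_in_strip[OF p]] by simp
qed

subsection \<open>Carleman estimate\<close>

text \<open>Unique continuation from a wall with zero Cauchy data: \<open>\<sigma> = 1\<close> for
  the lower wall, \<open>\<sigma> = -1\<close> for the upper. The Carleman error is controlled by
  \<open>q^2\<close>, not by \<open>v^2\<close>; the Hardy flux supplies \<open>q^2\<close> at a
  cost in \<open>a\<close> and \<open>v\<close> that a large \<open>\<tau>\<close> absorbs.\<close>

lemma v_vanishes_if_flat_side:
  fixes \<sigma> :: real
  assumes nondeg: "\<And>p. p \<in> strip d \<Longrightarrow> w p = 0 \<Longrightarrow> w2 p \<noteq> 0"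
    and side: "\<sigma> = 1 \<and> (\<forall>x\<in>{0..L}. v2 (x, -d) = 0) \<or> \<sigma> = -1 \<and> (\<forall>x\<in>{0..L}. v2 (x, d) = 0)"
    and p: "p \<in> {0..L} \<times> {-d..d}"
  shows "v p = 0"
proof -
  let ?R = "{0..L} \<times> {-d..d}"
  have R: "compact ?R" "?R \<noteq> {}" "?R \<subseteq> strip d"
    using L_pos d_pos rect_in_strip by (auto intro: compact_Times)
  have contR: "continuous_on ?R f" if "continuous_on (strip d) f" for f :: "real \<times> real \<Rightarrow> real"
    using that R(3) continuous_on_subset by blast
  have "continuous_on ?R (\<lambda>p. (w2 p)\<^sup>2 + (w p)\<^sup>2)" by (intro contR continuous_intros cont)
  from continuous_attains_inf[OF R(1,2) this] obtain p0 where
    p0: "p0 \<in> ?R" "\<And>p. p \<in> ?R \<Longrightarrow> (w2 p0)\<^sup>2 + (w p0)\<^sup>2 \<le> (w2 p)\<^sup>2 + (w p)\<^sup>2" by blast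
  \<comment> \<open>\<open>w2\<close> is known to be nonzero only at zeros of \<open>w\<close>;
    adding the square of \<open>w\<close> gives a quantity with a positive minimum on the compact
    cell.\<close>
  define \<delta> where "\<delta> = (w2 p0)\<^sup>2 + (w p0)\<^sup>2"
  have "w2 p0 \<noteq> 0 \<or> w p0 \<noteq> 0" using nondeg[of p0] rect_in_strip[OF p0(1)] by blast
  then have \<delta>: "\<delta> > 0" by (simp add: \<delta>_def sum_power2_gt_zero_iff)
  have "continuous_on ?R (\<lambda>p. \<bar>w22 p\<bar>)" by (intro contR continuous_intros cont)
  from continuous_attains_sup[OF R(1,2) this] obtain M where
    M: "\<And>p. p \<in> ?R \<Longrightarrow> \<bar>w22 p\<bar> \<le> M" by blast
  have "continuous_on ?R (\<lambda>p. (w11 p + w22 p - \<beta>)\<^sup>2)" by (intro contR continuous_intros cont)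
  from continuous_attains_sup[OF R(1,2) this] obtain N where
    N: "\<And>p. p \<in> ?R \<Longrightarrow> (w11 p + w22 p - \<beta>)\<^sup>2 \<le> N" by blast
  have "N \<ge> 0" using N[OF p0(1)] zero_le_power2 order_trans by blast
  \<comment> \<open>Chosen such that the Hardy gain in \<open>q^2\<close> exactly pays for the bound
    \<open>N * q^2\<close> on the squared Laplacian of \<open>v\<close>.\<close>
  define \<kappa> where "\<kappa> = 4 * N / \<delta>"
  have \<kappa>: "\<kappa> \<ge> 0" "\<kappa> * (\<delta> / 4) = N" using \<open>N \<ge> 0\<close> \<delta> by (simp_all add: \<kappa>_def)
  define C where "C = 1 / 2 + M\<^sup>2 / \<delta>"
  define r where "r = \<bar>\<kappa> * C + 1\<bar> / (4 * d\<^sup>2)"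
  \<comment> \<open>Large enough to absorb the Hardy losses: \<open>2 * \<kappa>\<close> in the
    square of \<open>a\<close>, and \<open>\<kappa> * C\<close> in that of \<open>v\<close> with one
    unit to spare.\<close>
  define \<tau> where "\<tau> = 1 + \<kappa> / 2 + r"
  have \<tau>: "\<tau> \<ge> 1" "2 * \<kappa> \<le> 4 * \<tau>" "\<kappa> * C + 1 \<le> 4 * \<tau> * d\<^sup>2"
  proof -
    have "r \<ge> 0" by (simp add: r_def)
    then show "\<tau> \<ge> 1" "2 * \<kappa> \<le> 4 * \<tau>" using \<kappa>(1) by (simp_all add: \<tau>_def)
    have "r * (4 * d\<^sup>2) \<le> \<tau> * (4 * d\<^sup>2)"
      unfolding \<tau>_def using \<kappa>(1) by (intro mult_right_mono) auto
    then show "\<kappa> * C + 1 \<le> 4 * \<tau> * d\<^sup>2" using d_pos by (simp add: r_def)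
  qed
  have \<sigma>: "\<sigma> = 1 \<or> \<sigma> = -1" using side by auto
  \<comment> \<open>\<open>E\<close> is the squared Carleman weight. Its centre
    \<open>2 * \<sigma> * d\<close> lies beyond the wall opposite the flat one, so
    \<open>\<psi>\<close> has a fixed sign and stays away from zero.\<close>
  define E where "E p = exp (\<tau> * (snd p - 2 * \<sigma> * d)\<^sup>2)" for p :: "real \<times> real"
  define \<psi> where "\<psi> p = \<tau> * (snd p - 2 * \<sigma> * d)" for p :: "real \<times> real"
  define a where "a p = v2 p + \<psi> p * v p" for p
  define a' where "a' p = v22 p + \<psi> p * v2 p + \<tau> * v p" for p
  define F where "F p = E p * (4 * \<psi> p * v1 p * a p + 2 * \<tau> * v p * v1 p)" for p
  define F' where "F' p = E p * (4 * \<psi> p * v11 p * a p + 4 * \<psi> p * v1 p * (v12 p + \<psi> p * v1 p)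
      + 2 * \<tau> * (v1 p)\<^sup>2 + 2 * \<tau> * v p * v11 p)" for p
  define G1 where "G1 p = 2 * \<psi> p * (a p)\<^sup>2 + 2 * \<tau> * v p * a p - 2 * \<psi> p * (v1 p)\<^sup>2
      + 2 * (\<psi> p)^3 * (v p)\<^sup>2" for p
  define G1' where "G1' p = 2 * \<tau> * (a p)\<^sup>2 + 4 * \<psi> p * a p * a' p + 2 * \<tau> * v2 p * a p + 2 * \<tau> * v p * a' p
      - 2 * \<tau> * (v1 p)\<^sup>2 - 4 * \<psi> p * v1 p * v12 p + 6 * (\<psi> p)\<^sup>2 * \<tau> * (v p)\<^sup>2 + 4 * (\<psi> p)^3 * v p * v2 p" for p
  \<comment> \<open>\<open>(F, E G1)\<close> is the Carleman flux and \<open>E H\<close> the Hardy flux; \<open>\<sigma>\<close> is chosen such that the boundary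
    term \<open>2 \<psi> E v\<^sub>y\<^sup>2\<close> on the side where \<open>v\<^sub>y\<close> need not vanish has the good sign.\<close>
  define H where "H p = w2 p * (q p * v p)" for p
  define H' where "H' p = w22 p * (q p * v p) + w2 p * (2 * q p * v2 p - (q p)\<^sup>2 * w2 p)" for p
  define G where "G p = E p * (G1 p - \<kappa> * H p)" for p
  define G' where "G' p = E p * (2 * \<psi> p * (G1 p - \<kappa> * H p) + (G1' p - \<kappa> * H' p))" for p
  have E_pos: "E p > 0" for p by (simp add: E_def)
  have dE: "((\<lambda>s. E (x, s)) has_real_derivative 2 * \<psi> (x, y) * E (x, y)) (at y within {-d..d})" for x y
    unfolding E_def \<psi>_def by (auto intro!: derivative_eq_intros)
  have d\<psi>: "((\<lambda>s. \<psi> (x, s)) has_real_derivative \<tau>) (at y within {-d..d})" for x y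
    unfolding \<psi>_def by (auto intro!: derivative_eq_intros)
  have day: "((\<lambda>s. a (x, s)) has_real_derivative a' (x, y)) (at y within {-d..d})"
    if y: "y \<in> {-d..d}" for x y
    unfolding a_def a'_def
    by (auto intro!: derivative_eq_intros has_ddyD[OF v2 y] has_ddyD[OF v22 y] d\<psi>)
  have dE_x: "((\<lambda>s. E (s, y)) has_real_derivative 0) (at x)"
    and d\<psi>_x: "((\<lambda>s. \<psi> (s, y)) has_real_derivative 0) (at x)" for x y
    by (simp_all add: E_def \<psi>_def)
  have dax: "((\<lambda>s. a (s, y)) has_real_derivative v12 (x, y) + \<psi> (x, y) * v1 (x, y)) (at x)"
    if y: "y \<in> {-d..d}" for x y
    unfolding a_def
    by (auto intro!: derivative_eq_intros d\<psi>_x has_ddxD[OF v21 y] has_ddxD[OF v1 y])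
  have cont': "continuous_on (strip d) E" "continuous_on (strip d) \<psi>"
    unfolding E_def \<psi>_def by (intro continuous_intros)+
  have cont'': "continuous_on (strip d) a" "continuous_on (strip d) a'"
    unfolding a_def a'_def by (intro continuous_intros cont cont')+
  have "E p * (v p)\<^sup>2 = 0"
  proof (rule vanishing_from_divergence[OF L_pos d_pos, where F=F and F'=F' and G=G and G'=G'])
    show "has_ddx d F F'" unfolding has_ddx_def
    proof (intro allI ballI)
      fix x y assume y: "y \<in> {-d..d}"
      show "((\<lambda>s. F (s, y)) has_real_derivative F' (x, y)) (at x)"
        unfolding F_def F'_def
        by (rule derivative_eq_intros refl dE_x d\<psi>_x dax[OF y] has_ddxD[OF v1 y] has_ddxD[OF v11 y])+
          (simp add: power2_eq_square algebra_simps)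
    qed
    show "has_ddy d G G'" unfolding has_ddy_def
    proof (intro allI ballI)
      fix x y assume y: "y \<in> {-d..d}"
      have G1: "((\<lambda>s. G1 (x, s)) has_real_derivative G1' (x, y)) (at y within {-d..d})"
        unfolding G1_def G1'_def
        by (rule derivative_eq_intros refl day[OF y] d\<psi> has_ddyD[OF v12 y] has_ddyD[OF v2 y])+
          (simp add: power2_eq_square power3_eq_cube algebra_simps)
      have qv: "((\<lambda>s. q (x, s) * v (x, s)) has_real_derivative
          2 * q (x, y) * v2 (x, y) - (q (x, y))\<^sup>2 * w2 (x, y)) (at y within {-d..d})"
        by (rule has_field_derivative_quotient_mult[OF has_ddyD[OF w2 y] has_ddyD[OF v2 y]
            factor[OF in_strip] slice_continuous_y[OF y] y at_y_nontrivial[OF y]])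
      have H: "((\<lambda>s. H (x, s)) has_real_derivative H' (x, y)) (at y within {-d..d})"
        unfolding H_def H'_def
        by (rule derivative_eq_intros refl qv has_ddyD[OF w22 y])+ (simp add: algebra_simps)
      show "((\<lambda>s. G (x, s)) has_real_derivative G' (x, y)) (at y within {-d..d})"
        unfolding G_def G'_def
        by (rule derivative_eq_intros refl G1 H dE)+ (simp add: algebra_simps)
    qed
    show "continuous_on (strip d) F'" "continuous_on (strip d) G'"
      "continuous_on (strip d) (\<lambda>p. E p * (v p)\<^sup>2)"
      unfolding F'_def G'_def G1_def G1'_def H_def H'_def
      by (intro continuous_intros cont cont' cont'')+
    show "periodic_x L d F"
      using per unfolding periodic_x_def F_def a_def E_def \<psi>_def by simp
    show "G (x, d) \<le> G (x, -d)" if "x \<in> {0..L}" for x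
    proof -
      have "G (x, d) = E (x, d) * (2 * \<psi> (x, d) * (v2 (x, d))\<^sup>2)"
        "G (x, -d) = E (x, -d) * (2 * \<psi> (x, -d) * (v2 (x, -d))\<^sup>2)"
        by (simp_all add: G_def G1_def H_def a_def boundary v1_boundary)
      then show ?thesis
        using side that d_pos \<tau>(1)
        by (auto simp: \<psi>_def E_pos less_imp_le mult_le_0_iff zero_le_mult_iff)
    qed
    fix p assume p: "p \<in> ?R"
    note ps = rect_in_strip[OF p]
    \<comment> \<open>\<open>X\<close> and \<open>Y\<close> are the divergences of the Carleman and
      Hardy fluxes divided by \<open>E\<close>, the second with its sign reversed.\<close>
    define X where "X = 4 * \<psi> p * v11 p * a p + 4 * \<psi> p * v1 p * (v12 p + \<psi> p * v1 p)
      + 2 * \<tau> * (v1 p)\<^sup>2 + 2 * \<tau> * v p * v11 p + 2 * \<psi> p * G1 p + G1' p"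
    define Y where "Y = (w2 p * q p)\<^sup>2 - 2 * w2 p * q p * a p - w22 p * q p * v p"
    have "F' p + G' p = E p * (X + \<kappa> * Y)"
      unfolding F'_def G'_def X_def Y_def H_def H'_def a_def
      by (simp add: algebra_simps power2_eq_square)
    moreover have "(v p)\<^sup>2 \<le> X + \<kappa> * Y"
    proof -
      have "4 * \<tau> * (a p)\<^sup>2 + 4 * \<tau> * (\<psi> p)\<^sup>2 * (v p)\<^sup>2 - (v11 p + v22 p)\<^sup>2 \<le> X"
        using carleman_pointwise[OF a_def[of p] a'_def[of p]] unfolding X_def G1_def G1'_def .
      moreover have "(v11 p + v22 p)\<^sup>2 \<le> N * (q p)\<^sup>2"
        unfolding vorticity[OF ps] power_mult_distrib using N[OF p] by (intro mult_right_mono) auto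
      moreover have "\<kappa> * (\<delta> / 4 * (q p)\<^sup>2 - 2 * (a p)\<^sup>2 - C * (v p)\<^sup>2) \<le> \<kappa> * Y"
        unfolding Y_def C_def
        using hardy_pointwise[OF \<delta> _ M[OF p] factor[OF ps]] p0(2)[OF p] \<kappa>(1)
        by (intro mult_left_mono) (auto simp: \<delta>_def)
      then have "N * (q p)\<^sup>2 - 2 * \<kappa> * (a p)\<^sup>2 - \<kappa> * C * (v p)\<^sup>2 \<le> \<kappa> * Y"
        unfolding \<kappa>(2)[symmetric] by (simp only: right_diff_distrib mult.assoc mult.left_commute)
      moreover have "2 * \<kappa> * (a p)\<^sup>2 \<le> 4 * \<tau> * (a p)\<^sup>2" using \<tau>(2) by (rule mult_right_mono) simp
      moreover have "(\<kappa> * C + 1) * (v p)\<^sup>2 \<le> 4 * \<tau> * (\<psi> p)\<^sup>2 * (v p)\<^sup>2"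
      proof (rule mult_right_mono)
        have "d \<le> \<bar>snd p - 2 * \<sigma> * d\<bar>" using p \<sigma> by auto
        also have "\<dots> \<le> \<bar>\<psi> p\<bar>"
          unfolding \<psi>_def abs_mult using mult_right_mono[OF \<tau>(1), of "\<bar>snd p - 2 * \<sigma> * d\<bar>"] \<tau>(1) by simp
        finally have "d\<^sup>2 \<le> (\<psi> p)\<^sup>2" using d_pos by (simp add: abs_le_square_iff[symmetric])
        then have "4 * \<tau> * d\<^sup>2 \<le> 4 * \<tau> * (\<psi> p)\<^sup>2" using \<tau>(1) by simp
        then show "\<kappa> * C + 1 \<le> 4 * \<tau> * (\<psi> p)\<^sup>2" using \<tau>(3) by linarith
      qed simp
      then have "\<kappa> * C * (v p)\<^sup>2 + (v p)\<^sup>2 \<le> 4 * \<tau> * (\<psi> p)\<^sup>2 * (v p)\<^sup>2" by (simp add: algebra_simps)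
      ultimately show ?thesis by linarith
    qed
    ultimately show "0 \<le> E p * (v p)\<^sup>2 \<and> E p * (v p)\<^sup>2 \<le> F' p + G' p"
      using E_pos[of p] by (simp add: less_imp_le)
  qed (rule p)
  then show ?thesis using E_pos[of p] by simp
qed

section \<open>Wave speeds above the minimum of u, for \<beta> > 0\<close>

lemma v_vanishes_if_w_negative_somewhere:
  assumes "\<beta> > 0" and grad: "\<And>p. p \<in> strip d \<Longrightarrow> w1 p \<noteq> 0 \<or> w2 p \<noteq> 0"
    and neg: "\<exists>p\<in>strip d. w p < 0"
    and p: "p \<in> {0..L} \<times> {-d..d}"
  shows "v p = 0"
proof -
  let ?R = "{0..L} \<times> {-d..d}"
  \<comment> \<open>With the cut-off to \<open>w < 0\<close> the energy density is a sum of
    nonnegative terms. As \<beta> > 0 it forces \<open>q = 0\<close>, hence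
    \<open>v2 = Z2 = 0\<close>, and incompressibility gives \<open>w1 = 0\<close>.\<close>
  have stat: "v2 p = 0 \<and> w1 p = 0" if p: "p \<in> ?R" "w p < 0" for p
  proof -
    have "cut 0 (w p) * ((Z1 p)\<^sup>2 + (Z2 p)\<^sup>2 - \<beta> * w p * (q p)\<^sup>2) = 0"
    proof (rule cut_energy_vanishes[OF p(1)])
      fix p
      show "0 \<le> cut 0 (w p) * ((Z1 p)\<^sup>2 + (Z2 p)\<^sup>2 - \<beta> * w p * (q p)\<^sup>2)"
      proof (cases "w p < 0")
        case True
        then have "cut 0 (w p) * ((Z1 p)\<^sup>2 + (Z2 p)\<^sup>2 - \<beta> * w p * (q p)\<^sup>2)
            = (Z1 p)\<^sup>2 + (Z2 p)\<^sup>2 + \<beta> * (- w p) * (q p)\<^sup>2" by (simp add: cut_def)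
        also have "0 \<le> \<dots>" using True \<beta>_nonneg
          by (intro add_nonneg_nonneg mult_nonneg_nonneg zero_le_power2) auto
        finally show ?thesis .
      qed (simp add: cut_def)
    qed
    then have sum: "(Z1 p)\<^sup>2 + (Z2 p)\<^sup>2 + \<beta> * (- w p) * (q p)\<^sup>2 = 0" using p(2) by (simp add: cut_def)
    have "0 \<le> \<beta> * (- w p) * (q p)\<^sup>2"
      using p(2) \<beta>_nonneg by (intro mult_nonneg_nonneg zero_le_power2) auto
    then have "(Z2 p)\<^sup>2 = 0" "\<beta> * (- w p) * (q p)\<^sup>2 = 0"
      using sum zero_le_power2[of "Z1 p"] zero_le_power2[of "Z2 p"] by linarith+
    then have "v2 p = 0" using p(2) \<open>\<beta> > 0\<close> by auto
    then show ?thesis using incompressible[OF rect_in_strip[OF p(1)]] by simp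
  qed
  \<comment> \<open>If \<open>w2\<close> vanished at a zero of \<open>w\<close>, then
    \<open>v2 = q * w2 = 0\<close> and so \<open>w1 = - v2 = 0\<close>, against the gradient
    condition.\<close>
  have nondeg: "w2 p \<noteq> 0" if "p \<in> strip d" "w p = 0" for p
    using gradient_factor_at_zero[OF that] incompressible[OF that(1)] grad[OF that(1)] by auto
  have "compact ?R" "?R \<noteq> {}" "continuous_on ?R w"
    using p rect_in_strip by (auto intro: compact_Times continuous_on_subset[OF cont(1)])
  from continuous_attains_inf[OF this] obtain x0 y0 where
    R0: "(x0, y0) \<in> ?R" and min_R: "\<And>p. p \<in> ?R \<Longrightarrow> w (x0, y0) \<le> w p" by auto
  have min: "w (x0, y0) \<le> w p" if "p \<in> strip d" for p
    using periodic_x_reduce[OF per(1) L_pos that] min_R by metis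
  have w0: "w (x0, y0) < 0" using neg min by force
  have y0: "y0 \<in> {-d..d}" and x0: "x0 \<in> {0..L}" using R0 by auto
  have "w1 (x0, y0) = 0"
    using DERIV_local_min[OF has_ddxD[OF w1 y0], of 1] min in_strip[OF y0] by simp
  with grad[OF in_strip[OF y0]] have w2_nz: "w2 (x0, y0) \<noteq> 0" by blast
  \<comment> \<open>An interior minimum would also have \<open>w2 = 0\<close>.\<close>
  have y0_cases: "y0 = -d \<or> y0 = d"
  proof (rule ccontr)
    assume "\<not> ?thesis"
    then have y: "-d < y0" "y0 < d" using y0 by auto
    then have "((\<lambda>s. w (x0, s)) has_real_derivative w2 (x0, y0)) (at y0)"
      using has_ddyD[OF w2 y0, of x0] by (simp add: at_within_Icc_at)
    moreover have "\<forall>y. \<bar>y0 - y\<bar> < min (y0 + d) (d - y0) \<longrightarrow> w (x0, y0) \<le> w (x0, y)"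
      by (intro allI impI min in_strip) auto
    moreover have "0 < min (y0 + d) (d - y0)" using y by simp
    ultimately have "w2 (x0, y0) = 0" using DERIV_local_min by blast
    with w2_nz show False by simp
  qed
  \<comment> \<open>Along this wall \<open>w1\<close> vanishes wherever \<open>w\<close> is
    negative, so the negative minimum value propagates over the whole period.\<close>
  have "w (x, y0) < 0" if "x \<in> {0..L}" for x
    using x0 w0 that
  proof (rule negative_on_interval[rotated 2])
    show "((\<lambda>s. w (s, y0)) has_real_derivative w1 (x, y0)) (at x within {0..L})" for x
      using has_ddxD[OF w1 y0] by (rule has_field_derivative_at_within)
  qed (use stat y0 in auto)
  then have "v2 (x, y0) = 0" if "x \<in> {0..L}" for x using stat that y0 by auto
  with y0_cases have "(1::real) = 1 \<and> (\<forall>x\<in>{0..L}. v2 (x, -d) = 0) \<or> (-1::real) = -1 \<and> (\<forall>x\<in>{0..L}. v2 (x, d) = 0)"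
    by auto
  then show ?thesis
    using v_vanishes_if_flat_side[OF nondeg _ p, of 1] v_vanishes_if_flat_side[OF nondeg _ p, of "-1"] by auto
qed

end

subsection \<open>Traveling waves\<close>

text \<open>The curl of the momentum equations. The pressure need not be twice differentiable a
  priori: its derivatives equal \<open>A\<close> and \<open>B\<close>, which can be
  differentiated.\<close>

lemma steady_vorticity_equation:
  assumes "d > 0" and u: "C2_strip d u" and v: "C2_strip d v" and P: "C1_strip d P"
    and mom_x: "\<And>p. p \<in> strip d \<Longrightarrow>
      (u p - c) * ddx u p + v p * ddy d u p - \<beta> * snd p * v p = - ddx P p"
    and mom_y: "\<And>p. p \<in> strip d \<Longrightarrow>
      (u p - c) * ddx v p + v p * ddy d v p + \<beta> * snd p * u p = - ddy d P p"
    and div: "\<And>p. p \<in> strip d \<Longrightarrow> ddx u p + ddy d v p = 0"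
    and p: "p \<in> strip d"
  shows "(u p - c) * laplacian d v p = v p * (laplacian d u p - \<beta>)"
proof -
  let ?y = "snd :: real \<times> real \<Rightarrow> real"
  have U: "C1_strip d u" "C1_strip d (ddx u)" "C1_strip d (ddy d u)"
    and V: "C1_strip d v" "C1_strip d (ddx v)" "C1_strip d (ddy d v)"
    using u v by (auto simp: C2_strip_def)
  note ux = C1_stripD[OF U(1)] C1_stripD[OF U(2)] C1_stripD[OF U(3)]
  note vx = C1_stripD[OF V(1)] C1_stripD[OF V(2)] C1_stripD[OF V(3)]
  define A where "A p = - ((u p - c) * ddx u p + v p * ddy d u p - \<beta> * snd p * v p)" for p
  define B where "B p = - ((u p - c) * ddx v p + v p * ddy d v p + \<beta> * snd p * u p)" for p
  define A2 where "A2 p = - (ddy d u p * ddx u p + (u p - c) * ddy d (ddx u) p + ddy d v p * ddy d u p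
      + v p * ddy d (ddy d u) p - \<beta> * v p - \<beta> * snd p * ddy d v p)" for p
  define B1 where "B1 p = - (ddx u p * ddx v p + (u p - c) * ddx (ddx v) p + ddx v p * ddy d v p
      + v p * ddx (ddy d v) p + \<beta> * snd p * ddx u p)" for p
  have PA: "has_ddx d P A" and PB: "has_ddy d P B"
    by (rule has_ddx_cong[OF C1_stripD(1)[OF P]], simp, use mom_x in \<open>simp add: A_def\<close>)
      (rule has_ddy_cong[OF C1_stripD(2)[OF P]], simp, use mom_y in \<open>simp add: B_def\<close>)
  have A2: "has_ddy d A A2" unfolding has_ddy_def
  proof (intro allI ballI)
    fix x y assume y: "y \<in> {-d..d}"
    show "((\<lambda>s. A (x, s)) has_real_derivative A2 (x, y)) (at y within {-d..d})"
      unfolding A_def A2_def fst_conv snd_conv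
      by (rule derivative_eq_intros refl has_ddyD[OF ux(2) y] has_ddyD[OF vx(2) y]
          has_ddyD[OF ux(7) y] has_ddyD[OF ux(12) y])+ (simp add: algebra_simps)
  qed
  have B1: "has_ddx d B B1" unfolding has_ddx_def
  proof (intro allI ballI)
    fix x y assume y: "y \<in> {-d..d}"
    show "((\<lambda>s. B (s, y)) has_real_derivative B1 (x, y)) (at x)"
      unfolding B_def B1_def fst_conv snd_conv
      by (rule derivative_eq_intros refl has_ddxD[OF ux(1) y] has_ddxD[OF vx(1) y]
          has_ddxD[OF vx(6) y] has_ddxD[OF vx(11) y])+ (simp add: algebra_simps)
  qed
  have cA: "continuous_on (strip d) A" "continuous_on (strip d) A2"
    unfolding A_def A2_def by (intro continuous_intros ux vx)+
  obtain x y where xy: "p = (x, y)" "y \<in> {-d..d}" using p by (auto simp: strip_def)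
  have curl: "A2 p = B1 p"
    using mixed_partials_commute[OF \<open>d > 0\<close> PA PB A2 B1 cA xy(2)] xy(1) by simp
  \<comment> \<open>Differentiated incompressibility turns mixed derivatives into pure ones, so that
    only Laplacians remain in the curl.\<close>
  have "has_ddy d (ddx u) (\<lambda>p. - ddy d (ddy d v) p)"
  proof (rule has_ddy_cong)
    show "has_ddy d (\<lambda>p. - ddy d v p) (\<lambda>p. - ddy d (ddy d v) p)"
      using vx(12) by (auto simp: has_ddy_def intro!: derivative_intros)
  qed (use div in \<open>auto simp: eq_neg_iff_add_eq_0\<close>)
  then have 1: "ddy d (ddx u) p = - ddy d (ddy d v) p"
    using has_ddy_unique[OF \<open>d > 0\<close> ux(7) _ p] by blast
  have "has_ddx d (ddy d v) (\<lambda>p. - ddx (ddx u) p)"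
  proof (rule has_ddx_cong)
    show "has_ddx d (\<lambda>p. - ddx u p) (\<lambda>p. - ddx (ddx u) p)"
      using ux(6) by (auto simp: has_ddx_def intro!: derivative_intros)
  qed (use div in \<open>auto simp: eq_neg_iff_add_eq_0 add.commute\<close>)
  then have 2: "ddx (ddy d v) p = - ddx (ddx u) p"
    using has_ddx_unique[OF vx(11) _ p] by blast
  have 3: "ddy d v p = - ddx u p" using div[OF p] by simp
  show ?thesis using curl unfolding A2_def B1_def 1 2 3 laplacian_def by (simp add: algebra_simps)
qed

lemma traveling_wave_steady:
  assumes "d > 0" and u: "C2_strip d u" and v: "C2_strip d v"
    and tw: "traveling_wave_solution \<beta> L d c u v"
  shows "p \<in> strip d \<Longrightarrow> (u p - c) * laplacian d v p = v p * (laplacian d u p - \<beta>)"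
    and "p \<in> strip d \<Longrightarrow> ddx u p + ddy d v p = 0"
    and "v (x, -d) = 0" "v (x, d) = 0"
proof -
  obtain P where sol: "beta_plane_solution \<beta> L d (traveling c u) (traveling c v) P"
    using tw by (auto simp: traveling_wave_solution_def)
  have t0: "traveling c f 0 = f" for f by (auto simp: traveling_def)
  \<comment> \<open>The profile equations are read off at time 0, where the time derivative is
    \<open>- c\<close> times the x-derivative.\<close>
  have dt: "ddt (traveling c f) 0 p = - c * ddx f p" if f: "C1_strip d f" and ps: "p \<in> strip d" for f p
  proof -
    obtain x y where p: "p = (x, y)" "y \<in> {-d..d}" using ps by (auto simp: strip_def)
    have "((\<lambda>s. f (x - c * s, y)) has_real_derivative ddx f (x, y) * (- c)) (at 0)"
      by (rule DERIV_chain2[where f="\<lambda>t. f (t, y)"])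
        (use has_ddxD[OF C1_stripD(1)[OF f] p(2), of x] in \<open>auto intro!: derivative_eq_intros\<close>)
    then show ?thesis
      by (simp add: ddt_def traveling_def p has_real_derivative_iff_has_vector_derivative vector_derivative_at)
  qed
  have C1: "C1_strip d u" "C1_strip d v" using u v by (auto simp: C2_strip_def)
  have P: "C1_strip d (P 0)" using sol unfolding beta_plane_solution_def by blast
  have eqs: "- c * ddx u p + u p * ddx u p + v p * ddy d u p - \<beta> * snd p * v p = - ddx (P 0) p
      \<and> - c * ddx v p + u p * ddx v p + v p * ddy d v p + \<beta> * snd p * u p = - ddy d (P 0) p
      \<and> ddx u p + ddy d v p = 0" if ps: "p \<in> strip d" for p
  proof -
    obtain x y where p: "p = (x, y)" "y \<in> {-d..d}" using ps by (auto simp: strip_def)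
    from sol have "\<forall>x. \<forall>y\<in>{-d..d}. let p = (x, y) in
          ddt (traveling c u) 0 p + traveling c u 0 p * ddx (traveling c u 0) p
            + traveling c v 0 p * ddy d (traveling c u 0) p - \<beta> * y * traveling c v 0 p = - ddx (P 0) p
        \<and> ddt (traveling c v) 0 p + traveling c u 0 p * ddx (traveling c v 0) p
            + traveling c v 0 p * ddy d (traveling c v 0) p + \<beta> * y * traveling c u 0 p = - ddy d (P 0) p
        \<and> ddx (traveling c u 0) p + ddy d (traveling c v 0) p = 0"
      unfolding beta_plane_solution_def by blast
    from this[rule_format, OF p(2), of x] show ?thesis
      using dt[OF C1(1) ps] dt[OF C1(2) ps] by (simp add: t0 Let_def p(1))
  qed
  show "(u p - c) * laplacian d v p = v p * (laplacian d u p - \<beta>)" if "p \<in> strip d"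
    by (rule steady_vorticity_equation[OF \<open>d > 0\<close> u v P _ _ _ that])
      (use eqs in \<open>auto simp: algebra_simps\<close>)
  show "ddx u p + ddy d v p = 0" if "p \<in> strip d" using eqs[OF that] by blast
  have "traveling c v 0 (x, -d) = 0 \<and> traveling c v 0 (x, d) = 0"
    using sol unfolding beta_plane_solution_def by blast
  then show "v (x, -d) = 0" "v (x, d) = 0" by (simp_all add: t0)
qed

text \<open>With \<open>k0 = pi / (2 * d)\<close>, the threshold is the larger root of
  \<open>k0^2 * a^2 = \<beta> * (a + M)\<close>, so the strict inequality holds beyond it.\<close>

lemma speed_below_threshold:
  fixes a M d \<beta> :: real
  assumes "\<beta> > 0" "d > 0" "M \<ge> 0"
    and a: "2 * \<beta> * d\<^sup>2 / pi\<^sup>2 + 2 * d\<^sup>2 / pi\<^sup>2 * sqrt (\<beta>\<^sup>2 + pi\<^sup>2 * \<beta> / d\<^sup>2 * M) < a"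
  obtains k where "0 < k" "k * d < pi / 2" "\<beta> * (a + M) < a\<^sup>2 * k\<^sup>2"
proof -
  define k0 where "k0 = pi / (2 * d)"
  have k0: "k0 > 0" using \<open>d > 0\<close> by (simp add: k0_def)
  define s where "s = sqrt (\<beta>\<^sup>2 + 4 * k0\<^sup>2 * \<beta> * M)"
  have s: "s \<ge> 0" "s\<^sup>2 = \<beta>\<^sup>2 + 4 * k0\<^sup>2 * \<beta> * M" using assms(1,3) by (simp_all add: s_def)
  have eq: "2 * d\<^sup>2 / pi\<^sup>2 = 1 / (2 * k0\<^sup>2)" "pi\<^sup>2 / d\<^sup>2 = 4 * k0\<^sup>2"
    using \<open>d > 0\<close> by (simp_all add: k0_def power_divide power_mult_distrib)
  have "pi\<^sup>2 * \<beta> / d\<^sup>2 * M = (pi\<^sup>2 / d\<^sup>2) * \<beta> * M" "2 * \<beta> * d\<^sup>2 / pi\<^sup>2 = 2 * d\<^sup>2 / pi\<^sup>2 * \<beta>" by simp_all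
  with a have a': "1 / (2 * k0\<^sup>2) * (\<beta> + s) < a"
    unfolding s_def by (simp only: eq distrib_left mult.assoc)
  then have "\<beta> + s < 2 * k0\<^sup>2 * a" using k0 by (simp add: field_simps)
  then have "s\<^sup>2 < (2 * k0\<^sup>2 * a - \<beta>)\<^sup>2" using s(1) by (intro power_strict_mono) auto
  then have "0 < 4 * k0\<^sup>2 * (k0\<^sup>2 * a\<^sup>2 - \<beta> * (a + M))"
    unfolding s(2) by (simp add: power2_eq_square algebra_simps)
  then have *: "\<beta> * (a + M) < k0\<^sup>2 * a\<^sup>2" using k0 by (simp add: zero_less_mult_iff)
  have "0 < 1 / (2 * k0\<^sup>2) * (\<beta> + s)" using k0 s(1) \<open>\<beta> > 0\<close> by simp
  with a' have "a > 0" by linarith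
  have "sqrt (\<beta> * (a + M)) < sqrt (k0\<^sup>2 * a\<^sup>2)" using * by simp
  then have "sqrt (\<beta> * (a + M)) / a < k0" using \<open>a > 0\<close> k0 by (simp add: real_sqrt_mult field_simps)
  \<comment> \<open>Strictness leaves room for \<open>k < k0\<close>, which keeps
    \<open>tan (k * y)\<close> finite up to the walls.\<close>
  then obtain k where k: "sqrt (\<beta> * (a + M)) / a < k" "k < k0" using dense by blast
  have "0 \<le> sqrt (\<beta> * (a + M)) / a" using assms \<open>a > 0\<close> by simp
  with k have "k > 0" by linarith
  moreover have "k * d < pi / 2" using k(2) \<open>d > 0\<close> by (simp add: k0_def field_simps)
  moreover have "sqrt (\<beta> * (a + M)) < k * a" using k(1) \<open>a > 0\<close> by (simp add: field_simps)
  then have "(sqrt (\<beta> * (a + M)))\<^sup>2 < (k * a)\<^sup>2" using assms \<open>a > 0\<close> by (intro power_strict_mono) auto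
  then have "\<beta> * (a + M) < a\<^sup>2 * k\<^sup>2" using assms \<open>a > 0\<close> by (simp add: power_mult_distrib mult.commute)
  ultimately show ?thesis using that by blast
qed

theorem theorem3p8:
  fixes L d \<beta> c :: real
    and u v :: "real \<times> real \<Rightarrow> real"
  assumes "L > 0" and "d > 0" and "\<beta> \<ge> 0"
    and "periodic_x L d u" and "periodic_x L d v"
    and "C2_strip d u" and "C2_strip d v"
    and "traveling_wave_solution \<beta> L d c u v"
    and "\<beta> \<notin> laplacian d u ` strip d"
    and "(\<beta> > 0 \<and> c \<notin> {c_beta_plus \<beta> d u..min_strip d u} \<and> (\<forall>p\<in>strip d. grad d u p \<noteq> 0))
         \<or> \<beta> = 0"
  shows "shear_flow d (traveling c u) (traveling c v)"
proof -
  define w where "w p = u p - c" for p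
  \<comment> \<open>The quotient of Laplacians instead of \<open>v / w\<close>: its denominator has
    no zero on the strip.\<close>
  define q where "q p = laplacian d v p / (laplacian d u p - \<beta>)" for p
  have U: "C1_strip d u" "C1_strip d (ddx u)" "C1_strip d (ddy d u)"
    and V: "C1_strip d v" "C1_strip d (ddx v)" "C1_strip d (ddy d v)"
    using assms by (auto simp: C2_strip_def)
  note ux = C1_stripD[OF U(1)] C1_stripD[OF U(2)] C1_stripD[OF U(3)]
  note vx = C1_stripD[OF V(1)] C1_stripD[OF V(2)] C1_stripD[OF V(3)]
  note steady = traveling_wave_steady[OF \<open>d > 0\<close> assms(6-8)]
  have K: "laplacian d u p - \<beta> \<noteq> 0" if "p \<in> strip d" for p using assms(9) that by auto
  have lap_cont: "continuous_on (strip d) (laplacian d u)" "continuous_on (strip d) (laplacian d v)"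
    unfolding laplacian_def by (intro continuous_intros ux vx)+
  have ux_per: "periodic_x L d (ddx u)" "periodic_x L d (ddy d u)"
    and vx_per: "periodic_x L d (ddx v)" "periodic_x L d (ddy d v)"
    using periodic_ddx[OF assms(4) ux(1)] periodic_ddy[OF assms(2,4) ux(2)]
      periodic_ddx[OF assms(5) vx(1)] periodic_ddy[OF assms(2,5) vx(2)] .
  have "periodic_x L d (ddx (ddx u))" "periodic_x L d (ddy d (ddy d u))"
    "periodic_x L d (ddx (ddx v))" "periodic_x L d (ddy d (ddy d v))"
    using periodic_ddx[OF ux_per(1) ux(6)] periodic_ddy[OF \<open>d > 0\<close> ux_per(2) ux(12)]
      periodic_ddx[OF vx_per(1) vx(6)] periodic_ddy[OF \<open>d > 0\<close> vx_per(2) vx(12)] .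
  then have q_per: "periodic_x L d q" unfolding q_def laplacian_def periodic_x_def by simp
  have v12: "has_ddx d (ddy d v) (ddy d (ddx v))"
  proof (rule has_ddx_cong[OF vx(11)])
    show "ddy d (ddx v) p = ddx (ddy d v) p" if "p \<in> strip d" for p
      using mixed_partials_commute[OF \<open>d > 0\<close> vx(1,2,7,11,4,10)] that by (auto simp: strip_def)
  qed simp
  interpret steady_wave L d \<beta> w v q "ddx u" "ddy d u" "ddx v" "ddy d v" "ddx (ddx u)" "ddy d (ddy d u)"
    "ddx (ddx v)" "ddy d (ddx v)" "ddy d (ddy d v)"
  proof
    show "has_ddx d w (ddx u)" "has_ddy d w (ddy d u)"
      using ux(1,2) by (auto simp: w_def has_ddx_def has_ddy_def intro!: derivative_eq_intros)
    show "continuous_on (strip d) w" unfolding w_def by (intro continuous_intros ux)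
    show "continuous_on (strip d) q"
      unfolding q_def using K by (intro continuous_intros lap_cont) auto
    show "periodic_x L d w" using assms(4) by (simp add: w_def periodic_x_def)
    fix p assume p: "p \<in> strip d"
    show "ddy d v p = - ddx u p" using steady(2)[OF p] by simp
    show "v p = q p * w p" using steady(1)[OF p] K[OF p] by (simp add: q_def w_def field_simps)
    show "ddx (ddx v) p + ddy d (ddy d v) p = (ddx (ddx u) p + ddy d (ddy d u) p - \<beta>) * q p"
      using K[OF p] unfolding q_def laplacian_def by simp
  qed (fact assms ux vx v12 ux_per vx_per q_per steady)+
  have bounded: "bounded (u ` strip d)" by (rule periodic_bounded_image[OF assms(1,4) ux(3)])
  have lower: "min_strip d u \<le> u p" and upper: "u p \<le> max_strip d u" if "p \<in> strip d" for p
    using bounded that unfolding min_strip_def max_strip_def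
    by (auto intro!: cInf_lower cSup_upper bounded_imp_bdd_below bounded_imp_bdd_above)
  have "v p = 0" if p: "p \<in> {0..L} \<times> {-d..d}" for p
  proof (cases "\<beta> = 0")
    case True
    then show ?thesis using p by (rule v_vanishes_if_beta_zero)
  next
    case False
    with assms(10) have "\<beta> > 0" and c: "c \<notin> {c_beta_plus \<beta> d u..min_strip d u}"
      and grad: "\<And>p. p \<in> strip d \<Longrightarrow> grad d u p \<noteq> 0" by auto
    show ?thesis
    proof (cases "c < c_beta_plus \<beta> d u")
      case True
      \<comment> \<open>\<open>a\<close> and \<open>a + M\<close> are the minimum and maximum of
        \<open>w\<close>.\<close>
      define a M where "a = min_strip d u - c" and "M = max_strip d u - min_strip d u"
      have "M \<ge> 0" using lower[OF rect_in_strip[OF p]] upper[OF rect_in_strip[OF p]] by (simp add: M_def)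
      have thr: "2 * \<beta> * d\<^sup>2 / pi\<^sup>2 + 2 * d\<^sup>2 / pi\<^sup>2 * sqrt (\<beta>\<^sup>2 + pi\<^sup>2 * \<beta> / d\<^sup>2 * M) < a"
        using True unfolding c_beta_plus_def a_def M_def by linarith
      moreover have "0 \<le> 2 * \<beta> * d\<^sup>2 / pi\<^sup>2 + 2 * d\<^sup>2 / pi\<^sup>2 * sqrt (\<beta>\<^sup>2 + pi\<^sup>2 * \<beta> / d\<^sup>2 * M)"
        using \<open>\<beta> > 0\<close> \<open>M \<ge> 0\<close> by simp
      ultimately have "a > 0" by linarith
      obtain k where "0 < k" "k * d < pi / 2" "\<beta> * (a + M) < a\<^sup>2 * k\<^sup>2"
        using speed_below_threshold[OF \<open>\<beta> > 0\<close> assms(2) \<open>M \<ge> 0\<close> thr] .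
      then show ?thesis
        using v_vanishes_if_w_large[of a "a + M" k p] \<open>a > 0\<close> lower upper p
        by (simp add: w_def a_def M_def)
    next
      case False
      with c have "min_strip d u < c" by auto
      moreover have "u ` strip d \<noteq> {}" using rect_in_strip[OF p] by auto
      ultimately have "\<exists>p\<in>strip d. u p < c"
        unfolding min_strip_def using cInf_lessD[of "u ` strip d" c] by auto
      then have "\<exists>p\<in>strip d. w p < 0" by (simp add: w_def)
      then show ?thesis
        using v_vanishes_if_w_negative_somewhere[OF \<open>\<beta> > 0\<close> _ _ p] grad by (simp add: grad_def zero_prod_def)
    qed
  qed
  note rect = this
  have "v p = 0" if p: "p \<in> strip d" for p
  proof -
    obtain p' where "p' \<in> {0..L} \<times> {-d..d}" "v p' = v p"
      using periodic_x_reduce[OF assms(5,1) p] .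
    then show ?thesis using rect[of p'] by simp
  qed
  then show ?thesis by (auto simp: shear_flow_def traveling_def strip_def)
qed

end
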